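(* Let $(\mu_k)_{k\in\mathbb{Z}}$ be a bi-sequence in $M^1(\mathbb{R}^d)$ and let $\phi$ be an invertible linear map of $\mathbb{R}^d$. Let $\tau:(\mathbb{R}^d)^{\mathbb{Z}}\to(\mathbb{R}^d)^{\mathbb{Z}}$ be the linear operator $\tau((v_i)_{i\in\mathbb{Z}})=(\phi(v_{i-1}))_{i\in\mathbb{Z}}$, and let $\mu\in M^1((\mathbb{R}^d)^{\mathbb{Z}})$ be the product measure of the $\mu_k$, $k\in\mathbb{Z}$. Consider the equation $$\lambda_k=\mu_k*\phi(\lambda_{k-1}),\qquad k\in\mathbb{Z}.\tag{E}$$ (i) If $\lambda\in M^1((\mathbb{R}^d)^{\mathbb{Z}})$ is a strongly $\tau$-decomposable measure with co-factor $\mu$, then $(\lambda_k)_{k\in\mathbb{Z}}$ with $\lambda_k=P_k(\lambda)$ is a fundamental solution of (E). (ii) If (E) has a solution, then there is a strongly $\tau$-decomposable measure on $(\mathbb{R}^d)^{\mathbb{Z}}$ with co-factor $\mu*\delta_v$ for some $v\in(\mathbb{R}^d)^{\mathbb{Z}}$. In particular, (E) then has a fundamental solution.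
   Context: For a complete separable metric vector space $V$, $M^1(V)$ is the space of Borel probability measures on $V$ with the weak topology (tested against bounded continuous functions); $*$ is convolution, $\delta_x$ is the Dirac measure at $x$, and for a continuous linear operator $T$, $T(\nu)(E)=\nu(T^{-1}(E))$. The space $(\mathbb{R}^d)^{\mathbb{Z}}$ of bi-sequences carries the product topology (coordinatewise convergence), and $P_k:(\mathbb{R}^d)^{\mathbb{Z}}\to\mathbb{R}^d$ is the $k$-th coordinate projection. A measure $\rho\in M^1(V)$ is $T$-decomposable with co-factor $\nu\in M^1(V)$ if $\rho=\nu*T(\rho)$; it is strongly $T$-decomposable if in addition $T^n(\rho)\to\delta_0$ as $n\to\infty$. A solution of (E) is a bi-sequence $(\lambda_k)_{k\in\mathbb{Z}}$ in $M^1(\mathbb{R}^d)$ satisfying (E) for all $k\in\mathbb{Z}$. A solution $(\lambda_k)$ is fundamental if for each solution $(\nu_k)$ of (E) there is $\nu\in M^1(\mathbb{R}^d)$ such that $\nu_k=\lambda_k*\phi^k(\nu)$ for all $k\in\mathbb{Z}$. *)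

theory Defs
  imports "HOL-Probability.Probability" "HOL-Library.Function_Algebras"
begin

text \<open>
  The space of bi-sequences in \<open>\<real>\<^sup>d\<close> is the type \<^typ>\<open>int \<Rightarrow> real^'d\<close>: its topology is the product
  topology (\<open>HOL-Analysis.Function_Topology\<close>), and its additive structure is the pointwise one
  (\<open>HOL-Library.Function_Algebras\<close>).
\<close>

definition borel_probs :: "'a::topological_space measure set" where
  "borel_probs = {M. prob_space M \<and> sets M = sets borel}"

definition weak_limit :: "(nat \<Rightarrow> 'a::topological_space measure) \<Rightarrow> 'a measure \<Rightarrow> bool" where
  "weak_limit M N \<longleftrightarrow> (\<forall>f::'a \<Rightarrow> real. continuous_on UNIV f \<longrightarrow> bounded (range f) \<longrightarrow>
     (\<lambda>n. integral\<^sup>L (M n) f) \<longlonglongrightarrow> integral\<^sup>L N f)"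

text \<open>
  The library constant \<^const>\<open>convolution\<close> is restricted to ordered Euclidean spaces, which excludes
  the space of bi-sequences; hence the same definition at a more general type.
\<close>

definition conv :: "'a::{topological_space, plus} measure \<Rightarrow> 'a measure \<Rightarrow> 'a measure"
    (infixl \<open>\<circledast>\<close> 70) where
  "M \<circledast> N = distr (M \<Otimes>\<^sub>M N) borel (\<lambda>(x, y). x + y)"

lemma conv_eq_convolution: "M \<circledast> N = convolution M N"
  by (simp add: conv_def convolution_def)

definition image_meas ::
    "('a::topological_space \<Rightarrow> 'b::topological_space) \<Rightarrow> 'a measure \<Rightarrow> 'b measure" where
  "image_meas T M = distr M borel T"

definition dirac :: "'a::topological_space \<Rightarrow> 'a measure" where
  "dirac x = return borel x"

definition decomposable ::
    "('a::{topological_space, plus} \<Rightarrow> 'a) \<Rightarrow> 'a measure \<Rightarrow> 'a measure \<Rightarrow> bool" where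
  "decomposable T \<nu> \<rho> \<longleftrightarrow>
     \<nu> \<in> borel_probs \<and> \<rho> \<in> borel_probs \<and> \<rho> = \<nu> \<circledast> image_meas T \<rho>"

definition strongly_decomposable ::
    "('a::{topological_space, plus, zero} \<Rightarrow> 'a) \<Rightarrow> 'a measure \<Rightarrow> 'a measure \<Rightarrow> bool" where
  "strongly_decomposable T \<nu> \<rho> \<longleftrightarrow>
     decomposable T \<nu> \<rho> \<and> weak_limit (\<lambda>n. image_meas (T ^^ n) \<rho>) (dirac 0)"

text \<open>The iterate \<open>f\<^sup>k\<close> of a bijection for an arbitrary integer \<open>k\<close>.\<close>

definition int_iterate :: "('a \<Rightarrow> 'a) \<Rightarrow> int \<Rightarrow> 'a \<Rightarrow> 'a" where
  "int_iterate f k = (if 0 \<le> k then f ^^ nat k else inv f ^^ nat (- k))"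

definition shift_op :: "('a \<Rightarrow> 'a) \<Rightarrow> (int \<Rightarrow> 'a) \<Rightarrow> int \<Rightarrow> 'a" where
  "shift_op \<phi> v = (\<lambda>i. \<phi> (v (i - 1)))"

definition coord :: "int \<Rightarrow> (int \<Rightarrow> 'a) \<Rightarrow> 'a" where
  "coord k v = v k"

definition product_meas :: "(int \<Rightarrow> 'a measure) \<Rightarrow> (int \<Rightarrow> 'a) measure" where
  "product_meas \<mu> = PiM UNIV \<mu>"

text \<open>
  The $\sigma$-algebra of \<^const>\<open>PiM\<close> is generated by the cylinders; for countably many second
  countable factors it is the Borel $\sigma$-algebra of the product topology.
\<close>

lemma product_meas_in_borel_probs:
  fixes \<mu> :: "int \<Rightarrow> 'a::second_countable_topology measure"
  assumes "\<And>k. \<mu> k \<in> borel_probs"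
  shows "product_meas \<mu> \<in> borel_probs"
proof -
  have "sets (PiM UNIV \<mu>) = sets (PiM UNIV (\<lambda>_::int. borel :: 'a measure))"
    using assms by (intro sets_PiM_cong) (auto simp: borel_probs_def)
  moreover have "prob_space (PiM UNIV \<mu>)"
    using assms by (intro prob_space_PiM) (auto simp: borel_probs_def)
  ultimately show ?thesis
    by (simp add: borel_probs_def product_meas_def sets_PiM_equal_borel)
qed

definition solution ::
    "(int \<Rightarrow> 'a::{topological_space, plus} measure) \<Rightarrow> ('a \<Rightarrow> 'a) \<Rightarrow> (int \<Rightarrow> 'a measure) \<Rightarrow> bool" where
  "solution \<mu> \<phi> \<Lambda> \<longleftrightarrow>
     (\<forall>k. \<Lambda> k \<in> borel_probs) \<and> (\<forall>k. \<Lambda> k = \<mu> k \<circledast> image_meas \<phi> (\<Lambda> (k - 1)))"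

definition fundamental_solution ::
    "(int \<Rightarrow> 'a::{topological_space, plus} measure) \<Rightarrow> ('a \<Rightarrow> 'a) \<Rightarrow> (int \<Rightarrow> 'a measure) \<Rightarrow> bool" where
  "fundamental_solution \<mu> \<phi> \<Lambda> \<longleftrightarrow> solution \<mu> \<phi> \<Lambda> \<and>
     (\<forall>N. solution \<mu> \<phi> N \<longrightarrow>
       (\<exists>\<nu>\<in>borel_probs. \<forall>k. N k = \<Lambda> k \<circledast> image_meas (int_iterate \<phi> k) \<nu>))"

end

(* Applying \<phi>^{-k} to the k-th measures turns (E) into \<Lambda>_k = \<mu>_k * \<Lambda>_{k-1}, so that a solution satisfies
   \<Lambda>_k = \<mu>_k * ... * \<mu>_{-n+1} * \<Lambda>_{-n}. For two solutions this gives \<Lambda>_k * N_{-n} = N_k * \<Lambda>_{-n}. If \<Lambda>_{-n}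
   tends to \<delta>_0 (up to translations, which is all that is needed), then the right hand side converges
   to N_k, hence the N_{-n} are tight, and a limit point \<nu> of them satisfies N_k = \<Lambda>_k * \<nu>.

   Conversely, given a solution N, pick a_n such that N_{-n} * \<delta>(a_n) has half of its mass in a fixed
   ball. Then the blocks \<mu>_k * ... * \<mu>_{-n+1} * \<delta>(-a_n) are tight for every k, and a diagonal
   subsequence of them converges to a solution \<Lambda>. Along it \<Lambda>_{-n} * \<delta>(a_n) has a limit point \<kappa> with
   \<Lambda>_0 = \<Lambda>_0 * \<kappa>, so \<kappa> = \<delta>_0 by characteristic functions. Since convolving can only increase the
   spread of a measure, all the \<Lambda>_{-n} concentrate, and the product of the recentred \<Lambda>_k is strongly
   decomposable.

   Compactness of tight families on R^d is reduced to Helly's theorem on the line by a space-filling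
   curve. *)
theory Submission
  imports Defs "HOL-Library.Diagonal_Subsequence"
begin

text \<open>In (ii) a solution \<open>N\<close> controls the blocks only up to translation. The
  translations a_n must therefore be chosen once for all k: a separate centring of each block would
  spoil the recursion that the limits have to inherit. The ball that defines a_n comes from
  \<open>N 0\<close> alone, and half of the mass suffices because a factor with half of its mass in
  a fixed ball passes the tightness of a convolution on to the other factor.

  The identity for \<kappa> compares two facts: \<Lambda>_0 is the limit of the recentred blocks
  from 0 down to -n+1 along the diagonal, and it is also each such block convolved with the
  oppositely shifted \<Lambda>_{-n}. This gives concentration along a subsequence only. Since
  \<Lambda>_{-n} is a factor of \<Lambda>_{-n+1}, the spread is monotone and the whole sequence
  concentrates, possibly around new centres.

  The convergence in strong decomposability reduces to marginals: \<tau>^n sends coordinate k - n to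
  coordinate k through \<phi>^n, and a basic neighbourhood of 0 restricts finitely many coordinates.
  Independent coupling is chosen because it matches the product form of the co-factor.\<close>

subsection \<open>A space-filling curve\<close>

text \<open>The distance from \<open>t\<close> to the nearest even integer; the form with
  \<open>arccos\<close> gives continuity and period 2 at once.\<close>

definition triangle_wave :: "real \<Rightarrow> real" where
  "triangle_wave t = arccos (cos (pi * t)) / pi"

text \<open>Schoenberg's function: 0 where the wave is at most 1/3, 1 where it is at least 2/3, and
  linear in between.\<close>

definition digit_fun :: "real \<Rightarrow> real" where
  "digit_fun t = max 0 (min 1 (3 * triangle_wave t - 1))"

lemma triangle_wave_even_shift:
  assumes "0 \<le> u" "u \<le> 1"
  shows "triangle_wave (2 * of_int N + u) = u"
proof -
  have "cos (pi * (2 * of_int N + u)) = cos (pi * u + (2 * pi) * of_int N)"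
    by (simp add: algebra_simps)
  also have "\<dots> = cos (pi * u)"
    by (metis add.commute cos_int_2pin cos_add mult.commute mult_1 sin_int_2pin mult_zero_left diff_zero)
  finally show ?thesis
    using assms by (simp add: triangle_wave_def arccos_cos mult_left_le)
qed

lemma continuous_on_triangle_wave: "continuous_on UNIV triangle_wave"
  unfolding triangle_wave_def
  by (intro continuous_intros) auto

lemma continuous_on_digit_fun: "continuous_on UNIV digit_fun"
  unfolding digit_fun_def
  by (intro continuous_intros continuous_on_triangle_wave)

lemma digit_fun_bounds: "0 \<le> digit_fun t" "digit_fun t \<le> 1"
  by (auto simp: digit_fun_def)

definition cantor_sum :: "(nat \<Rightarrow> int) \<Rightarrow> real" where
  "cantor_sum d = (\<Sum>m. 2 * of_int (d m) / 3 ^ Suc m)"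

lemma third_sums: "(\<lambda>m. 2 / 3 ^ Suc m :: real) sums 1"
proof -
  have "(\<lambda>m. (2/3) * (1/3) ^ m :: real) sums ((2/3) * (1 / (1 - 1/3)))"
    by (intro sums_mult geometric_sums) auto
  then show ?thesis by (simp add: power_divide)
qed

lemma summable_cantor:
  assumes "\<And>m. d m \<in> {0, 1::int}"
  shows "summable (\<lambda>m. 2 * of_int (d m) / 3 ^ Suc m :: real)"
proof (rule summable_comparison_test'[OF sums_summable[OF third_sums]])
  fix n :: nat
  show "norm (2 * of_int (d n) / 3 ^ Suc n :: real) \<le> 2 / 3 ^ Suc n"
    using assms[of n] by auto
qed

lemma cantor_sum_bounds:
  assumes "\<And>m. d m \<in> {0, 1::int}"
  shows "0 \<le> cantor_sum d" "cantor_sum d \<le> 1"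
proof -
  have nn: "0 \<le> real_of_int (d m)" "real_of_int (d m) \<le> 1" for m
    using assms[of m] by auto
  show "0 \<le> cantor_sum d"
    unfolding cantor_sum_def using summable_cantor[of d, OF assms]
    by (intro suminf_nonneg divide_nonneg_nonneg mult_nonneg_nonneg nn) simp_all
  have "cantor_sum d \<le> (\<Sum>m. 2 / 3 ^ Suc m)"
    unfolding cantor_sum_def using summable_cantor[of d, OF assms] sums_summable[OF third_sums]
    by (intro suminf_le divide_right_mono) (use nn in simp_all)
  then show "cantor_sum d \<le> 1"
    using third_sums by (simp add: sums_iff)
qed

text \<open>All ternary digits \<open>2 * d i\<close> are even, so after multiplication by
  \<open>3 ^ m\<close> the earlier digits and \<open>2 * N\<close> add up to an even integer, which
  the wave ignores. The rest is \<open>2 * d m / 3\<close> plus at most 1/3, hence on the plateau of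
  \<open>digit_fun\<close> that belongs to \<open>d m\<close>.\<close>

lemma digit_fun_cantor_sum:
  assumes d: "\<And>m. d m \<in> {0, 1::int}"
  shows "digit_fun (3 ^ m * (2 * of_int N + cantor_sum d)) = of_int (d m)"
proof -
  define tl where "tl = cantor_sum (\<lambda>i. d (i + Suc m))"
  have tl: "0 \<le> tl" "tl \<le> 1"
    unfolding tl_def by (rule cantor_sum_bounds; rule d)+
  have "cantor_sum d = (\<Sum>i. 2 * of_int (d (i + Suc m)) / 3 ^ Suc (i + Suc m)) + (\<Sum>i<Suc m. 2 * of_int (d i) / 3 ^ Suc i)"
    unfolding cantor_sum_def by (rule suminf_split_initial_segment[OF summable_cantor[OF d]])
  also have "(\<Sum>i. 2 * of_int (d (i + Suc m)) / 3 ^ Suc (i + Suc m)) = (\<Sum>i. (1 / 3 ^ Suc m) * (2 * of_int (d (i + Suc m)) / 3 ^ Suc i) :: real)"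
    by (simp add: power_add field_simps)
  also have "\<dots> = 1 / 3 ^ Suc m * tl"
    unfolding tl_def cantor_sum_def by (intro suminf_mult summable_cantor d)
  finally have cs: "cantor_sum d = tl / 3 ^ Suc m + (\<Sum>i<Suc m. 2 * of_int (d i) / 3 ^ Suc i)"
    by simp
  define K where "K = (\<Sum>i<m. d i * 3 ^ (m - Suc i))"
  have "3 ^ m * (\<Sum>i<m. 2 * of_int (d i) / 3 ^ Suc i) = (2 * of_int K :: real)"
    unfolding K_def sum_distrib_left of_int_sum
  proof (intro sum.cong refl)
    fix i assume "i \<in> {..<m}"
    then have "3 ^ m = (3 ^ Suc i * 3 ^ (m - Suc i) :: real)"
      by (simp flip: power_add power_Suc)
    then show "3 ^ m * (2 * of_int (d i) / 3 ^ Suc i) = (2 * of_int (d i * 3 ^ (m - Suc i)) :: real)"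
      by simp
  qed
  then have eq: "3 ^ m * (2 * of_int N + cantor_sum d)
      = 2 * of_int (3 ^ m * N + K) + (2 * of_int (d m) / 3 + tl / 3)"
    by (simp add: cs algebra_simps)
  have "triangle_wave (3 ^ m * (2 * of_int N + cantor_sum d)) = 2 * of_int (d m) / 3 + tl / 3"
    unfolding eq using tl d[of m] by (intro triangle_wave_even_shift) auto
  then show ?thesis
    using tl d[of m] by (auto simp: digit_fun_def)
qed

section \<open>Binary digits and a Borel section of the curve\<close>

definition binary_digit :: "nat \<Rightarrow> real \<Rightarrow> int" where
  "binary_digit j y = \<lfloor>2 ^ Suc j * y\<rfloor> mod 2"

lemma binary_digit_in: "binary_digit j y \<in> {0, 1}"
  by (auto simp: binary_digit_def)

lemma binary_expansion:
  assumes "0 \<le> y" "y < 1"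
  shows "(\<lambda>j. of_int (binary_digit j y) / 2 ^ Suc j) sums y"
proof -
  have part: "(\<Sum>j<n. of_int (binary_digit j y) / 2 ^ Suc j) = of_int \<lfloor>2 ^ n * y\<rfloor> / (2 ^ n :: real)" for n
  proof (induction n)
    case 0
    then show ?case using assms by (simp add: floor_eq_iff)
  next
    case (Suc n)
    have "\<lfloor>2 ^ n * y\<rfloor> = \<lfloor>2 ^ Suc n * y\<rfloor> div 2"
      using floor_divide_real_eq_div[of 2 "2 ^ Suc n * y"] by simp
    then have "\<lfloor>2 ^ Suc n * y\<rfloor> = 2 * \<lfloor>2 ^ n * y\<rfloor> + binary_digit n y"
      by (simp add: binary_digit_def)
    then have "real_of_int \<lfloor>2 ^ Suc n * y\<rfloor> = 2 * of_int \<lfloor>2 ^ n * y\<rfloor> + of_int (binary_digit n y)"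
      by simp
    with Suc show ?case by (simp add: field_simps)
  qed
  have "(\<lambda>n. of_int \<lfloor>2 ^ n * y\<rfloor> / (2 ^ n :: real)) \<longlonglongrightarrow> y"
  proof (rule LIM_zero_cancel, rule Lim_transform_bound)
    show "\<forall>\<^sub>F n in sequentially. norm (of_int \<lfloor>2 ^ n * y\<rfloor> / (2 ^ n :: real) - y) \<le> norm ((1/2) ^ n :: real)"
    proof (intro always_eventually allI)
      fix n :: nat
      have "of_int \<lfloor>2 ^ n * y\<rfloor> / (2 ^ n :: real) - y = (of_int \<lfloor>2 ^ n * y\<rfloor> - 2 ^ n * y) / 2 ^ n"
        by (simp add: field_simps)
      moreover have "\<bar>of_int \<lfloor>2 ^ n * y\<rfloor> - 2 ^ n * y\<bar> \<le> 1"
        by linarith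
      ultimately show "norm (of_int \<lfloor>2 ^ n * y\<rfloor> / (2 ^ n :: real) - y) \<le> norm ((1/2) ^ n :: real)"
        by (simp add: power_divide divide_right_mono)
    qed
    show "(\<lambda>n. (1/2) ^ n :: real) \<longlonglongrightarrow> 0"
      by (rule LIMSEQ_power_zero) simp
  qed
  then show ?thesis by (simp only: sums_def part)
qed

text \<open>
  As in Schoenberg's curve, \<open>digit_fun (3 ^ m * t)\<close> reads off the \<open>m\<close>-th digit of a point of the
  Cantor set. The points \<open>2 * N + u\<close> with \<open>u\<close> in the Cantor set are mapped onto the cube of radius
  \<open>N + 1\<close>, by the factor \<open>1 + (t - triangle_wave t) / 2\<close>.
\<close>

definition curve :: "real \<Rightarrow> real ^ 'd::finite" where
  "curve t = (\<chi> i. (1 + (t - triangle_wave t) / 2) *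
     (2 * (\<Sum>j. digit_fun (3 ^ to_nat (i, j) * t) / 2 ^ Suc j) - 1))"

text \<open>The coordinates of \<open>x\<close>, rescaled from the cube of radius
  \<open>floor (norm x) + 1\<close> to the unit interval, have their binary digits interleaved by a
  numbering of the pairs (coordinate, position).\<close>

definition curve_digits :: "real ^ 'd::finite \<Rightarrow> nat \<Rightarrow> int" where
  "curve_digits x m = (case from_nat m :: 'd \<times> nat of
     (i, j) \<Rightarrow> binary_digit j ((x $ i / (of_int \<lfloor>norm x\<rfloor> + 1) + 1) / 2))"

definition curve_section :: "real ^ 'd::finite \<Rightarrow> real" where
  "curve_section x = 2 * of_int \<lfloor>norm x\<rfloor> + cantor_sum (curve_digits x)"

lemma half_sums: "(\<lambda>m. 1 / 2 ^ Suc m :: real) sums 1"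
  using sums_mult[OF geometric_sums[of "1/2::real"], of "1/2"] by (simp add: power_divide)

lemma continuous_on_curve: "continuous_on UNIV (curve :: real \<Rightarrow> real ^ 'd)"
proof -
  have "continuous_on UNIV (\<lambda>t. \<Sum>j. digit_fun (3 ^ to_nat (i, j) * t) / 2 ^ Suc j)" for i :: 'd
  proof (rule uniform_limit_theorem[OF _ Weierstrass_m_test[where M = "\<lambda>j. 1 / 2 ^ Suc j"]])
    show "\<forall>\<^sub>F n in sequentially. continuous_on UNIV (\<lambda>t. \<Sum>j<n. digit_fun (3 ^ to_nat (i, j) * t) / 2 ^ Suc j)"
      by (intro always_eventually allI continuous_intros
            continuous_on_compose2[OF continuous_on_digit_fun]) auto
    show "norm (digit_fun (3 ^ to_nat (i, n) * x) / 2 ^ Suc n) \<le> 1 / 2 ^ Suc n" for n x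
      using digit_fun_bounds by (simp add: divide_right_mono)
  qed (use half_sums in \<open>auto simp: sums_iff\<close>)
  then show ?thesis
    unfolding curve_def by (intro continuous_intros continuous_on_triangle_wave) auto
qed

lemma curve_digits_in: "curve_digits x m \<in> {0, 1}"
  unfolding curve_digits_def using binary_digit_in by (auto split: prod.split)

text \<open>The wave returns the Cantor part of \<open>curve_section x\<close>, so the scaling
  factor of \<open>curve\<close> is \<open>N + 1\<close>; the digit functions then return the
  interleaved binary digits. The strict bound \<open>norm x < N + 1\<close> keeps the rescaled
  coordinates below 1, as the binary expansion demands.\<close>

lemma curve_section:
  fixes x :: "real ^ 'd"
  shows "curve (curve_section x) = x"
proof -
  define N where "N = real_of_int \<lfloor>norm x\<rfloor>"
  define u where "u = cantor_sum (curve_digits x)"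
  have N: "0 \<le> N" "norm x < N + 1" by (simp_all add: N_def)
  have "triangle_wave (curve_section x) = u"
    unfolding curve_section_def u_def
    by (intro triangle_wave_even_shift cantor_sum_bounds curve_digits_in)
  then have r: "1 + (curve_section x - triangle_wave (curve_section x)) / 2 = N + 1"
    by (simp add: curve_section_def N_def u_def)
  have "(\<Sum>j. digit_fun (3 ^ to_nat (i, j) * curve_section x) / 2 ^ Suc j) = (x $ i / (N + 1) + 1) / 2" for i
  proof -
    let ?y = "(x $ i / (N + 1) + 1) / 2"
    have "\<bar>x $ i\<bar> < N + 1" using component_le_norm_cart[of x i] N by linarith
    then have "\<bar>x $ i / (N + 1)\<bar> < 1" using N by (simp add: abs_mult)
    then have "0 \<le> ?y \<and> ?y < 1" unfolding abs_less_iff by auto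
    then have "(\<lambda>j. of_int (binary_digit j ?y) / 2 ^ Suc j) sums ?y" by (intro binary_expansion) auto
    moreover have "digit_fun (3 ^ to_nat (i, j) * curve_section x) = of_int (binary_digit j ?y)" for j
      unfolding curve_section_def
      by (subst digit_fun_cantor_sum[OF curve_digits_in]) (simp add: curve_digits_def N_def)
    ultimately show ?thesis by (simp add: sums_iff)
  qed
  note s = this
  have "curve (curve_section x) $ i = x $ i" for i
    unfolding curve_def vec_lambda_beta r s using N by (simp add: field_simps)
  then show ?thesis
    by (simp add: vec_eq_iff)
qed

lemma borel_measurable_curve_section: "curve_section \<in> borel_measurable borel"
proof -
  have "(\<lambda>x :: real ^ 'd. of_int (curve_digits x m) :: real) \<in> borel_measurable borel" for m
    unfolding curve_digits_def binary_digit_def by (cases "from_nat m :: 'd \<times> nat") simp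
  then show ?thesis
    unfolding curve_section_def cantor_sum_def by measurable
qed

text \<open>Balls go to bounded intervals; this is how tightness passes to the line.\<close>

lemma curve_section_bounded:
  assumes "norm x \<le> r"
  shows "\<bar>curve_section x\<bar> \<le> 2 * r + 1"
proof -
  have "0 \<le> real_of_int \<lfloor>norm x\<rfloor>" "real_of_int \<lfloor>norm x\<rfloor> \<le> norm x" by simp_all
  moreover have "0 \<le> cantor_sum (curve_digits x)" "cantor_sum (curve_digits x) \<le> 1"
    by (rule cantor_sum_bounds; rule curve_digits_in)+
  ultimately show ?thesis
    using assms unfolding curve_section_def by linarith
qed

subsection \<open>Convolution and weak limits of probability measures\<close>

lemma borel_probsD:
  assumes "M \<in> borel_probs"
  shows "prob_space M" "sets M = sets borel" "space M = UNIV"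
  using assms sets_eq_imp_space_eq[of M borel] by (auto simp: borel_probs_def)

lemma borel_probs_measurable:
  assumes "M \<in> borel_probs" "f \<in> borel_measurable borel"
  shows "f \<in> borel_measurable M"
  using assms measurable_cong_sets[OF borel_probsD(2)[OF assms(1)] refl] by blast

lemma image_meas_in_borel_probs:
  assumes "M \<in> borel_probs" "T \<in> borel_measurable borel"
  shows "image_meas T M \<in> borel_probs"
  using assms prob_space.prob_space_distr[OF borel_probsD(1) borel_probs_measurable]
  by (auto simp: borel_probs_def image_meas_def)

lemma dirac_in_borel_probs: "dirac x \<in> borel_probs"
  by (simp add: borel_probs_def dirac_def prob_space_return)

lemma integral_dirac:
  fixes f :: "'a::topological_space \<Rightarrow> 'b::{banach, second_countable_topology}"
  assumes "f \<in> borel_measurable borel"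
  shows "integral\<^sup>L (dirac x) f = f x"
  using assms by (simp add: dirac_def integral_return)

lemma integral_image_meas:
  fixes f :: "'b::topological_space \<Rightarrow> 'c::{banach, second_countable_topology}"
  assumes "M \<in> borel_probs" "T \<in> borel_measurable borel" "f \<in> borel_measurable borel"
  shows "integral\<^sup>L (image_meas T M) f = (\<integral>x. f (T x) \<partial>M)"
  unfolding image_meas_def using assms borel_probs_measurable by (blast intro: integral_distr)

lemma integrable_borel_probs:
  fixes f :: "'a::topological_space \<Rightarrow> 'b::{banach, second_countable_topology}"
  assumes "M \<in> borel_probs" "f \<in> borel_measurable borel" "\<And>x. norm (f x) \<le> B"
  shows "integrable M f"
proof -
  interpret prob_space M by (rule borel_probsD[OF assms(1)])
  show ?thesis
    using assms by (intro integrable_const_bound[where B = B] borel_probs_measurable[OF assms(1,2)]) auto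
qed

lemma measurable_borel_add:
  "(\<lambda>(x, y). x + y) \<in> borel_measurable (borel \<Otimes>\<^sub>M (borel :: 'a::{second_countable_topology, topological_monoid_add} measure))"
  unfolding borel_prod split_beta
  by (intro borel_measurable_continuous_onI continuous_intros)

lemma measurable_add_borel_probs:
  fixes M N :: "'a::{second_countable_topology, topological_monoid_add} measure"
  assumes "M \<in> borel_probs" "N \<in> borel_probs"
  shows "(\<lambda>(x, y). x + y) \<in> borel_measurable (M \<Otimes>\<^sub>M N)"
  using measurable_borel_add
  by (subst measurable_cong_sets[OF sets_pair_measure_cong[OF borel_probsD(2)[OF assms(1)]
          borel_probsD(2)[OF assms(2)]] refl])

lemma conv_in_borel_probs:
  fixes M N :: "'a::{second_countable_topology, topological_monoid_add} measure"
  assumes "M \<in> borel_probs" "N \<in> borel_probs"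
  shows "M \<circledast> N \<in> borel_probs"
proof -
  interpret M: prob_space M by (rule borel_probsD[OF assms(1)])
  interpret N: prob_space N by (rule borel_probsD[OF assms(2)])
  interpret pair_prob_space M N ..
  show ?thesis
    unfolding borel_probs_def conv_def
    by (auto intro: prob_space_distr measurable_add_borel_probs assms)
qed

lemma
  fixes f :: "'a::{second_countable_topology, topological_monoid_add} \<Rightarrow> 'b::{banach, second_countable_topology}"
  assumes M: "M \<in> borel_probs" and N: "N \<in> borel_probs"
    and f: "f \<in> borel_measurable borel" and B: "\<And>x. norm (f x) \<le> B"
  shows integral_conv: "integral\<^sup>L (M \<circledast> N) f = (\<integral>x. (\<integral>y. f (x + y) \<partial>N) \<partial>M)"
    and integral_conv_swap: "integral\<^sup>L (M \<circledast> N) f = (\<integral>y. (\<integral>x. f (x + y) \<partial>M) \<partial>N)"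
    and borel_measurable_integral_shift: "(\<lambda>x. \<integral>y. f (x + y) \<partial>N) \<in> borel_measurable borel"
proof -
  interpret M: prob_space M by (rule borel_probsD[OF M])
  interpret N: prob_space N by (rule borel_probsD[OF N])
  interpret pair_prob_space M N ..
  have m: "(\<lambda>(x, y). f (x + y)) \<in> borel_measurable (M \<Otimes>\<^sub>M N)"
    using measurable_compose[OF measurable_add_borel_probs[OF M N] f] by (simp add: split_beta)
  then have i: "integrable (M \<Otimes>\<^sub>M N) (\<lambda>(x, y). f (x + y))"
    using B by (intro P.integrable_const_bound[where B = B]) auto
  have "integral\<^sup>L (M \<circledast> N) f = (\<integral>z. f (fst z + snd z) \<partial>(M \<Otimes>\<^sub>M N))"
    unfolding conv_def
    by (subst integral_distr[OF measurable_add_borel_probs[OF M N] f]) (simp add: split_beta)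
  then show "integral\<^sup>L (M \<circledast> N) f = (\<integral>x. (\<integral>y. f (x + y) \<partial>N) \<partial>M)"
    "integral\<^sup>L (M \<circledast> N) f = (\<integral>y. (\<integral>x. f (x + y) \<partial>M) \<partial>N)"
    using integral_fst'[OF i[unfolded split_beta]] integral_snd[OF i] by (simp_all add: case_prod_beta')
  have "(\<lambda>x. \<integral>y. f (x + y) \<partial>N) \<in> borel_measurable M"
    using N.borel_measurable_lebesgue_integral[OF m] by simp
  then show "(\<lambda>x. \<integral>y. f (x + y) \<partial>N) \<in> borel_measurable borel"
    using measurable_cong_sets[OF borel_probsD(2)[OF M] refl] by blast
qed

section \<open>Uniqueness and stability of weak limits\<close>

lemma borel_probs_eqI:
  assumes "M \<in> borel_probs" "N \<in> borel_probs"
    and eq: "\<And>F. closed F \<Longrightarrow> measure M F = measure N F"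
  shows "M = N"
proof (rule measure_eqI_generator_eq[where E = "Collect closed" and \<Omega> = UNIV and A = "\<lambda>_. UNIV"])
  interpret M: prob_space M by (rule borel_probsD[OF assms(1)])
  interpret N: prob_space N by (rule borel_probsD[OF assms(2)])
  show "sets M = sigma_sets UNIV (Collect closed)" "sets N = sigma_sets UNIV (Collect closed)"
    using borel_probsD[OF assms(1)] borel_probsD[OF assms(2)]
    by (simp_all add: borel_eq_closed)
  show "emeasure M F = emeasure N F" if "F \<in> Collect closed" for F
    using eq that by (simp add: M.emeasure_eq_measure N.emeasure_eq_measure)
qed (auto simp: Int_stable_def finite_measure.emeasure_finite prob_space.finite_measure
      borel_probsD[OF assms(1)])

lemma borel_probs_eqI_integral:
  fixes M N :: "'a::metric_space measure"
  assumes M: "M \<in> borel_probs" and N: "N \<in> borel_probs"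
    and eq: "\<And>f :: 'a \<Rightarrow> real. continuous_on UNIV f \<Longrightarrow> bounded (range f) \<Longrightarrow> integral\<^sup>L M f = integral\<^sup>L N f"
  shows "M = N"
proof (rule borel_probs_eqI[OF M N])
  fix F :: "'a set" assume F: "closed F"
  interpret M: prob_space M by (rule borel_probsD[OF M])
  interpret N: prob_space N by (rule borel_probsD[OF N])
  show "measure M F = measure N F"
  \<comment> \<open>The empty set is separate because \<open>infdist x {}\<close> is 0 by
    convention, which would make every \<open>f n\<close> below constantly 1.\<close>
  proof (cases "F = {}")
    case False
    \<comment> \<open>Continuous functions decreasing to the indicator of \<open>F\<close>.\<close>
    define f where "f n x = max 0 (1 - real n * infdist x F)" for n x
    have cont: "continuous_on UNIV (f n)" for n
      unfolding f_def by (intro continuous_intros)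
    have bd: "\<bar>f n x\<bar> \<le> 1" for n x
      by (auto simp: f_def infdist_nonneg)
    have lim: "(\<lambda>n. f n x) \<longlonglongrightarrow> indicat_real F x" for x
    proof (cases "x \<in> F")
      case True
      then show ?thesis by (simp add: f_def)
    next
      case x: False
      then have pos: "infdist x F > 0"
        using in_closed_iff_infdist_zero[OF F False] infdist_nonneg[of x F] by force
      obtain k :: nat where "1 / infdist x F < k" using reals_Archimedean2 by blast
      then have "1 < k * infdist x F" using pos by (simp add: field_simps)
      have "f n x = 0" if "k \<le> n" for n
      proof -
        have "k * infdist x F \<le> n * infdist x F"
          using pos that by (intro mult_right_mono) auto
        with \<open>1 < k * infdist x F\<close> show ?thesis by (simp add: f_def)
      qed
      then have "\<forall>\<^sub>F n in sequentially. f n x = 0"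
        unfolding eventually_sequentially by blast
      then show ?thesis using x by (simp add: tendsto_eventually)
    qed
    have "(\<lambda>n. integral\<^sup>L K (f n)) \<longlonglongrightarrow> measure K F" if K: "K \<in> borel_probs" for K
    proof -
      interpret K: prob_space K by (rule borel_probsD[OF K])
      have "(\<lambda>n. integral\<^sup>L K (f n)) \<longlonglongrightarrow> integral\<^sup>L K (indicat_real F)"
        using F bd lim borel_measurable_continuous_onI[OF cont]
        by (intro integral_dominated_convergence[where w = "\<lambda>_. 1"] borel_probs_measurable[OF K]) auto
      then show ?thesis using F borel_probsD[OF K] by simp
    qed
    from this[OF M] this[OF N] have "(\<lambda>n. integral\<^sup>L M (f n)) \<longlonglongrightarrow> measure M F"
      "(\<lambda>n. integral\<^sup>L N (f n)) \<longlonglongrightarrow> measure N F" .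
    moreover have "integral\<^sup>L M (f n) = integral\<^sup>L N (f n)" for n
      using bd by (intro eq cont) (auto simp: bounded_iff)
    ultimately show ?thesis
      using LIMSEQ_unique by simp
  qed simp
qed

lemma weak_limitD:
  assumes "weak_limit M N" "continuous_on UNIV f" "\<And>x. \<bar>f x\<bar> \<le> (B::real)"
  shows "(\<lambda>n. integral\<^sup>L (M n) f) \<longlonglongrightarrow> integral\<^sup>L N f"
  using assms by (auto simp: weak_limit_def bounded_iff)

lemma weak_limitI:
  assumes "\<And>f B. continuous_on UNIV f \<Longrightarrow> (\<And>x. \<bar>f x\<bar> \<le> (B::real)) \<Longrightarrow>
    (\<lambda>n. integral\<^sup>L (M n) f) \<longlonglongrightarrow> integral\<^sup>L N f"
  shows "weak_limit M N"
  unfolding weak_limit_def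
proof safe
  fix f :: "'a \<Rightarrow> real" assume f: "continuous_on UNIV f" "bounded (range f)"
  then obtain B where "\<And>x. \<bar>f x\<bar> \<le> B" by (auto simp: bounded_iff)
  with f(1) show "(\<lambda>n. integral\<^sup>L (M n) f) \<longlonglongrightarrow> integral\<^sup>L N f" by (rule assms)
qed

lemma weak_limit_unique:
  fixes N N' :: "'a::metric_space measure"
  assumes "weak_limit M N" "weak_limit M N'" "N \<in> borel_probs" "N' \<in> borel_probs"
  shows "N = N'"
proof (rule borel_probs_eqI_integral[OF assms(3,4)])
  fix f :: "'a \<Rightarrow> real" assume "continuous_on UNIV f" "bounded (range f)"
  with assms(1,2) show "integral\<^sup>L N f = integral\<^sup>L N' f"
    unfolding weak_limit_def by (blast intro: LIMSEQ_unique)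
qed

lemma weak_limit_const: "weak_limit (\<lambda>n. N) N"
  by (simp add: weak_limit_def)

lemma weak_limit_subseq:
  assumes "weak_limit M N" "strict_mono s"
  shows "weak_limit (M \<circ> s) N"
  using assms LIMSEQ_subseq_LIMSEQ[OF _ assms(2)] unfolding weak_limit_def by (fastforce simp: o_def)

lemma weak_limit_cong:
  assumes "weak_limit M N" "\<forall>\<^sub>F n in sequentially. M n = M' n"
  shows "weak_limit M' N"
  unfolding weak_limit_def
proof safe
  fix f :: "'a \<Rightarrow> real" assume "continuous_on UNIV f" "bounded (range f)"
  then have "(\<lambda>n. integral\<^sup>L (M n) f) \<longlonglongrightarrow> integral\<^sup>L N f"
    using assms by (simp add: weak_limit_def)
  then show "(\<lambda>n. integral\<^sup>L (M' n) f) \<longlonglongrightarrow> integral\<^sup>L N f"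
    by (rule Lim_transform_eventually) (use assms(2) in \<open>auto elim: eventually_mono\<close>)
qed

lemma weak_limit_image:
  fixes T :: "'a::topological_space \<Rightarrow> 'b::topological_space"
  assumes "weak_limit M N" "\<And>n. M n \<in> borel_probs" "N \<in> borel_probs" "continuous_on UNIV T"
  shows "weak_limit (\<lambda>n. image_meas T (M n)) (image_meas T N)"
proof (rule weak_limitI)
  fix f :: "'b \<Rightarrow> real" and B assume f: "continuous_on UNIV f" "\<And>x. \<bar>f x\<bar> \<le> B"
  have "continuous_on UNIV (\<lambda>x. f (T x))"
    using continuous_on_compose2[OF f(1) assms(4)] by simp
  then show "(\<lambda>n. integral\<^sup>L (image_meas T (M n)) f) \<longlonglongrightarrow> integral\<^sup>L (image_meas T N) f"
    using weak_limitD[OF assms(1), of "\<lambda>x. f (T x)" B] f assms(2-4)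
    by (simp add: integral_image_meas borel_measurable_continuous_onI)
qed

text \<open>Only the second factor varies. Integrating \<open>M\<close> out turns the test function
  into \<open>g\<close>, which is again bounded and, by dominated convergence, continuous.\<close>

lemma weak_limit_conv:
  fixes M :: "'a::{second_countable_topology, topological_monoid_add, metric_space} measure"
  assumes "weak_limit N K" "M \<in> borel_probs" "\<And>n. N n \<in> borel_probs" "K \<in> borel_probs"
  shows "weak_limit (\<lambda>n. M \<circledast> N n) (M \<circledast> K)"
proof (rule weak_limitI)
  fix f :: "'a \<Rightarrow> real" and B assume f: "continuous_on UNIV f" "\<And>x. \<bar>f x\<bar> \<le> B"
  interpret M: prob_space M by (rule borel_probsD[OF assms(2)])
  have fm: "f \<in> borel_measurable borel" using f by (simp add: borel_measurable_continuous_onI)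
  have fs: "(\<lambda>x. f (x + y)) \<in> borel_measurable borel" for y
    by (intro borel_measurable_continuous_onI continuous_on_compose2[OF f(1)] continuous_intros) auto
  define g where "g y = (\<integral>x. f (x + y) \<partial>M)" for y
  have "continuous_on UNIV g"
    unfolding continuous_on_sequentially
  proof (intro ballI allI impI, elim conjE)
    fix X :: "nat \<Rightarrow> 'a" and a assume X: "X \<longlonglongrightarrow> a"
    have "(\<lambda>n. f (x + X n)) \<longlonglongrightarrow> f (x + a)" for x
      by (rule continuous_on_tendsto_compose[OF f(1)]) (auto intro!: tendsto_intros X)
    then show "(g \<circ> X) \<longlonglongrightarrow> g a"
      unfolding g_def o_def using f(2)
      by (intro integral_dominated_convergence[where w = "\<lambda>_. B"] borel_probs_measurable[OF assms(2)] fs) auto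
  qed
  moreover have "\<bar>g y\<bar> \<le> B" for y
  proof -
    have "\<bar>g y\<bar> \<le> (\<integral>x. \<bar>f (x + y)\<bar> \<partial>M)" unfolding g_def by (rule integral_abs_bound)
    also have "\<dots> \<le> (\<integral>x. B \<partial>M)"
      using f(2) integrable_borel_probs[OF assms(2) fs, of y B]
      by (intro integral_mono) auto
    finally show ?thesis by (simp add: M.prob_space)
  qed
  ultimately show "(\<lambda>n. integral\<^sup>L (M \<circledast> N n) f) \<longlonglongrightarrow> integral\<^sup>L (M \<circledast> K) f"
    using weak_limitD[OF assms(1), of g B] integral_conv_swap[OF assms(2) _ fm, of _ B] f(2) assms(3,4)
    by (simp flip: g_def)
qed

section \<open>Algebra of convolution, translations and images\<close>

lemma conv_commute:
  fixes M N :: "'a::ordered_euclidean_space measure"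
  assumes "M \<in> borel_probs" "N \<in> borel_probs"
  shows "M \<circledast> N = N \<circledast> M"
  unfolding conv_eq_convolution using assms
  by (intro convolution_commutative prob_space.finite_measure) (auto simp: borel_probs_def)

lemma conv_assoc:
  fixes L M N :: "'a::ordered_euclidean_space measure"
  assumes "L \<in> borel_probs" "M \<in> borel_probs" "N \<in> borel_probs"
  shows "(L \<circledast> M) \<circledast> N = L \<circledast> (M \<circledast> N)"
  unfolding conv_eq_convolution using assms
  by (intro convolution_associative[symmetric] prob_space.finite_measure) (auto simp: borel_probsD)

lemma emeasure_conv:
  fixes M N :: "'a::{second_countable_topology, topological_monoid_add} measure"
  assumes M: "M \<in> borel_probs" and N: "N \<in> borel_probs" and A: "A \<in> sets borel"
  shows "emeasure (M \<circledast> N) A = (\<integral>\<^sup>+x. emeasure N {y. x + y \<in> A} \<partial>M)"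
proof -
  interpret M: prob_space M by (rule borel_probsD[OF M])
  interpret N: prob_space N by (rule borel_probsD[OF N])
  note add = measurable_add_borel_probs[OF M N]
  have sp: "space (M \<Otimes>\<^sub>M N) = UNIV"
    using borel_probsD[OF M] borel_probsD[OF N] by (simp add: space_pair_measure)
  have "emeasure (M \<circledast> N) A = emeasure (M \<Otimes>\<^sub>M N) ((\<lambda>(x, y). x + y) -` A \<inter> space (M \<Otimes>\<^sub>M N))"
    unfolding conv_def by (rule emeasure_distr[OF add A])
  also have "\<dots> = (\<integral>\<^sup>+x. emeasure N (Pair x -` ((\<lambda>(x, y). x + y) -` A \<inter> space (M \<Otimes>\<^sub>M N))) \<partial>M)"
    by (rule N.emeasure_pair_measure_alt[OF measurable_sets[OF add A]])
  finally show ?thesis by (simp add: sp vimage_def)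
qed

lemma conv_dirac:
  fixes M :: "'a::{second_countable_topology, topological_monoid_add} measure"
  assumes M: "M \<in> borel_probs"
  shows "M \<circledast> dirac b = image_meas (\<lambda>x. x + b) M"
proof (rule measure_eqI)
  show "sets (M \<circledast> dirac b) = sets (image_meas (\<lambda>x. x + b) M)"
    by (simp add: conv_def image_meas_def)
  fix A assume "A \<in> sets (M \<circledast> dirac b)"
  then have A: "A \<in> sets borel" by (simp add: conv_def)
  have s: "(\<lambda>x. x + b) \<in> borel_measurable borel" "\<And>x. (\<lambda>y. x + y) \<in> borel_measurable (borel :: 'a measure)"
    by (intro borel_measurable_continuous_onI continuous_on_add continuous_on_id continuous_on_const)+
  have [simp]: "{x. x + b \<in> A} \<in> sets borel" "\<And>x. {y. x + y \<in> A} \<in> sets borel"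
    using measurable_sets[OF s(1) A] measurable_sets[OF s(2) A] by (simp_all add: vimage_def)
  have "emeasure (M \<circledast> dirac b) A = (\<integral>\<^sup>+x. indicator {x. x + b \<in> A} x \<partial>M)"
    unfolding emeasure_conv[OF M dirac_in_borel_probs A]
    by (auto intro!: nn_integral_cong simp: dirac_def indicator_def)
  also have "\<dots> = emeasure M {x. x + b \<in> A}"
    by (rule nn_integral_indicator) (simp add: borel_probsD[OF M])
  also have "\<dots> = emeasure (image_meas (\<lambda>x. x + b) M) A"
    unfolding image_meas_def using A M
    by (subst emeasure_distr[OF borel_probs_measurable[OF M s(1)]]) (auto simp: borel_probsD vimage_def)
  finally show "emeasure (M \<circledast> dirac b) A = emeasure (image_meas (\<lambda>x. x + b) M) A" .
qed

lemma image_meas_image_meas: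
  assumes "M \<in> borel_probs" "T \<in> borel_measurable borel" "S \<in> borel_measurable borel"
  shows "image_meas S (image_meas T M) = image_meas (S \<circ> T) M"
  unfolding image_meas_def using assms borel_probs_measurable by (blast intro: distr_distr)

lemma image_meas_id: "M \<in> borel_probs \<Longrightarrow> image_meas (\<lambda>x. x) M = M"
  using borel_probsD(2)[of M] by (simp add: image_meas_def distr_id2)

lemma conv_dirac_0:
  fixes M :: "'a::{second_countable_topology, topological_monoid_add} measure"
  shows "M \<in> borel_probs \<Longrightarrow> M \<circledast> dirac 0 = M"
  by (simp add: conv_dirac image_meas_id)

lemma image_meas_dirac:
  assumes "T \<in> borel_measurable borel"
  shows "image_meas T (dirac x) = dirac (T x)"
  using assms by (simp add: image_meas_def dirac_def distr_return)

lemma image_meas_conv: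
  fixes M N :: "'a::{second_countable_topology, topological_monoid_add} measure"
    and T :: "'a \<Rightarrow> 'b::{second_countable_topology, topological_monoid_add}"
  assumes M: "M \<in> borel_probs" and N: "N \<in> borel_probs"
    and T: "T \<in> borel_measurable borel" and add: "\<And>x y. T (x + y) = T x + T y"
  shows "image_meas T (M \<circledast> N) = image_meas T M \<circledast> image_meas T N"
proof (rule measure_eqI)
  show "sets (image_meas T (M \<circledast> N)) = sets (image_meas T M \<circledast> image_meas T N)"
    by (simp add: conv_def image_meas_def)
  fix A assume "A \<in> sets (image_meas T (M \<circledast> N))"
  then have A: "A \<in> sets borel" by (simp add: image_meas_def)
  have TM: "T \<in> borel_measurable K" if "K \<in> borel_probs" for K using borel_probs_measurable[OF that T] .
  have "(\<lambda>y. x + y) \<in> borel_measurable borel" for x :: 'b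
    by (intro borel_measurable_continuous_onI continuous_on_add continuous_on_id continuous_on_const)
  from measurable_sets[OF this A] have shift: "{y. x + y \<in> A} \<in> sets borel" for x
    by (simp add: vimage_def)
  have e: "emeasure (image_meas T K) B = emeasure K {x. T x \<in> B}" if "K \<in> borel_probs" "B \<in> sets borel" for K B
    unfolding image_meas_def using that
    by (subst emeasure_distr[OF TM]) (auto simp: borel_probsD vimage_def)
  have "{x. T x \<in> A} \<in> sets borel" using measurable_sets[OF T A] by (simp add: vimage_def)
  then have "emeasure (image_meas T (M \<circledast> N)) A = (\<integral>\<^sup>+x. emeasure N {y. T x + T y \<in> A} \<partial>M)"
    by (simp add: e conv_in_borel_probs M N A emeasure_conv add)
  also have "\<dots> = (\<integral>\<^sup>+x. emeasure (image_meas T N) {y. T x + y \<in> A} \<partial>M)"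
    by (simp add: e N shift)
  also have "\<dots> = (\<integral>\<^sup>+x. emeasure (image_meas T N) {y. x + y \<in> A} \<partial>image_meas T M)"
  proof -
    interpret N: prob_space "image_meas T N"
      using image_meas_in_borel_probs[OF N T] by (rule borel_probsD)
    have "{z \<in> space (image_meas T M \<Otimes>\<^sub>M image_meas T N). fst z + snd z \<in> A} \<in> sets (image_meas T M \<Otimes>\<^sub>M image_meas T N)"
      using measurable_sets[OF measurable_add_borel_probs[OF image_meas_in_borel_probs[OF M T]
            image_meas_in_borel_probs[OF N T]] A]
      by (simp add: split_beta vimage_def Int_def conj_commute)
    from N.measurable_emeasure_Pair[OF this]
    have "(\<lambda>x. emeasure (image_meas T N) {y. x + y \<in> A}) \<in> borel_measurable (image_meas T M)"
      by (simp add: image_meas_def space_pair_measure vimage_def)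
    then show ?thesis
      unfolding image_meas_def[of T M] by (subst nn_integral_distr[OF TM[OF M]]) auto
  qed
  also have "\<dots> = emeasure (image_meas T M \<circledast> image_meas T N) A"
    by (rule emeasure_conv[symmetric]) (auto intro: image_meas_in_borel_probs M N T A)
  finally show "emeasure (image_meas T (M \<circledast> N)) A = emeasure (image_meas T M \<circledast> image_meas T N) A" .
qed

subsection \<open>Tightness\<close>

text \<open>The bound is asked for large \<open>n\<close> only, since the factorisations to which it
  is applied hold only once \<open>n\<close> has passed a given index. For sequences of Borel
  probabilities this still yields a uniform bound, see
  \<open>eventually_tight_uniform\<close>.\<close>

definition eventually_tight :: "(nat \<Rightarrow> 'a::real_normed_vector measure) \<Rightarrow> bool" where
  "eventually_tight M \<longleftrightarrow>
     (\<forall>\<epsilon>>0. \<exists>r. \<forall>\<^sub>F n in sequentially. measure (M n) {x. r < norm x} \<le> \<epsilon>)"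

lemma norm_sets_borel:
  "{x :: 'a::real_normed_vector. r < norm x} \<in> sets borel" "{x :: 'a. norm x \<le> r} \<in> sets borel"
proof -
  show "{x :: 'a. r < norm x} \<in> sets borel"
    by (rule borel_open, rule open_Collect_less) (intro continuous_intros)+
  show "{x :: 'a. norm x \<le> r} \<in> sets borel"
    by (rule borel_closed, rule closed_Collect_le) (intro continuous_intros)+
qed

lemma measure_norm_le:
  fixes M :: "'a::real_normed_vector measure"
  assumes "M \<in> borel_probs"
  shows "measure M {x. norm x \<le> r} = 1 - measure M {x. r < norm x}"
proof -
  interpret prob_space M by (rule borel_probsD[OF assms])
  have "{x :: 'a. norm x \<le> r} = space M - {x. r < norm x}"
    using borel_probsD[OF assms] by auto
  then show ?thesis
    using borel_probsD(2)[OF assms] norm_sets_borel[of r] by (simp add: prob_compl)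
qed

lemma measure_norm_gr_mono:
  fixes M :: "'a::real_normed_vector measure"
  assumes "M \<in> borel_probs" "r \<le> r'"
  shows "measure M {x. r' < norm x} \<le> measure M {x. r < norm x}"
proof -
  interpret prob_space M by (rule borel_probsD[OF assms(1)])
  show ?thesis
    using assms(2) borel_probsD(2)[OF assms(1)] norm_sets_borel[of r] by (intro finite_measure_mono) auto
qed

lemma ex_measure_norm_le:
  fixes M :: "'a::real_normed_vector measure"
  assumes M: "M \<in> borel_probs" and "0 < \<epsilon>"
  shows "\<exists>r. measure M {x. r < norm x} \<le> \<epsilon>"
proof -
  interpret prob_space M by (rule borel_probsD[OF M])
  have "(\<lambda>n. measure M {x. real n < norm x}) \<longlonglongrightarrow> measure M (\<Inter>n. {x. real n < norm x})"
  proof (rule finite_Lim_measure_decseq)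
    show "range (\<lambda>n. {x. real n < norm x}) \<subseteq> events"
      by (auto simp: borel_probsD(2)[OF M] norm_sets_borel(1))
    show "decseq (\<lambda>n. {x :: 'a. real n < norm x})"
      by (rule decseq_SucI) auto
  qed
  moreover have "(\<Inter>n. {x :: 'a. real n < norm x}) = {}"
  proof (intro equals0I)
    fix x assume "x \<in> (\<Inter>n. {x :: 'a. real n < norm x})"
    then show False using reals_Archimedean2[of "norm x"] by (auto dest: less_asym)
  qed
  ultimately have "(\<lambda>n. measure M {x. real n < norm x}) \<longlonglongrightarrow> 0" by simp
  then have "\<forall>\<^sub>F n in sequentially. measure M {x. real n < norm x} < \<epsilon>"
    using \<open>0 < \<epsilon>\<close> by (rule order_tendstoD)
  then show ?thesis
    by (auto simp: eventually_sequentially intro: less_imp_le)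
qed

lemma eventually_tightI_weak_limit:
  fixes M :: "nat \<Rightarrow> 'a::real_normed_vector measure"
  assumes wl: "weak_limit M N" and M: "\<And>n. M n \<in> borel_probs" and N: "N \<in> borel_probs"
  shows "eventually_tight M"
  unfolding eventually_tight_def
proof (intro allI impI)
  fix \<epsilon> :: real assume "0 < \<epsilon>"
  then obtain r where r: "measure N {x. r < norm x} \<le> \<epsilon> / 2"
    using ex_measure_norm_le[OF N, of "\<epsilon> / 2"] by auto
  \<comment> \<open>A continuous ramp between the indicators of \<open>r + 1 < norm x\<close> and
    \<open>r < norm x\<close>.\<close>
  define f :: "'a \<Rightarrow> real" where "f x = max 0 (min 1 (norm x - r))" for x
  have f: "continuous_on UNIV f" "\<And>x. \<bar>f x\<bar> \<le> 1"
    unfolding f_def by (intro continuous_intros) auto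
  note fm = borel_measurable_continuous_onI[OF f(1)]
  have "integral\<^sup>L N f \<le> integral\<^sup>L N (indicator {x. r < norm x})"
    using f(2) by (intro integral_mono integrable_borel_probs[OF N, where B = 1] fm
        borel_measurable_indicator norm_sets_borel) (auto simp: f_def indicator_def)
  also have "\<dots> < \<epsilon>"
    using r \<open>0 < \<epsilon>\<close> by (simp add: borel_probsD[OF N])
  finally have "\<forall>\<^sub>F n in sequentially. integral\<^sup>L (M n) f < \<epsilon>"
    using weak_limitD[OF wl f] by (rule order_tendstoD(2)[rotated])
  moreover have "measure (M n) {x. r + 1 < norm x} \<le> integral\<^sup>L (M n) f" for n
  proof -
    have "integral\<^sup>L (M n) (indicator {x. r + 1 < norm x}) \<le> integral\<^sup>L (M n) f"
      using f(2) by (intro integral_mono integrable_borel_probs[OF M, where B = 1] fm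
          borel_measurable_indicator norm_sets_borel) (auto simp: f_def indicator_def)
    then show ?thesis by (simp add: borel_probsD[OF M])
  qed
  ultimately show "\<exists>r. \<forall>\<^sub>F n in sequentially. measure (M n) {x. r < norm x} \<le> \<epsilon>"
    by (intro exI[of _ "r + 1"]) (auto elim!: eventually_mono intro: order_trans less_imp_le)
qed

lemma eventually_tight_cong:
  assumes "eventually_tight M" "\<forall>\<^sub>F n in sequentially. M n = M' n"
  shows "eventually_tight M'"
  unfolding eventually_tight_def
proof (intro allI impI)
  fix \<epsilon> :: real assume "0 < \<epsilon>"
  then obtain r where "\<forall>\<^sub>F n in sequentially. measure (M n) {x. r < norm x} \<le> \<epsilon>"
    using assms(1) by (auto simp: eventually_tight_def)
  with assms(2) have "\<forall>\<^sub>F n in sequentially. measure (M' n) {x. r < norm x} \<le> \<epsilon>"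
    by eventually_elim simp
  then show "\<exists>r. \<forall>\<^sub>F n in sequentially. measure (M' n) {x. r < norm x} \<le> \<epsilon>" ..
qed

lemma eventually_tight_subseq:
  assumes "eventually_tight M" "strict_mono s"
  shows "eventually_tight (M \<circ> s)"
  using assms eventually_subseq[OF assms(2)] unfolding eventually_tight_def o_def by meson

lemma eventually_tight_half:
  assumes "eventually_tight M" "\<And>n. M n \<in> borel_probs"
  shows "\<exists>r. \<forall>\<^sub>F n in sequentially. 1 / 2 \<le> measure (M n) {x. norm x \<le> r}"
proof -
  obtain r where "\<forall>\<^sub>F n in sequentially. measure (M n) {x. r < norm x} \<le> 1 / 2"
    using assms(1) unfolding eventually_tight_def by (meson half_gt_zero zero_less_one)
  then have "\<forall>\<^sub>F n in sequentially. 1 / 2 \<le> measure (M n) {x. norm x \<le> r}"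
    by eventually_elim (simp add: measure_norm_le assms(2))
  then show ?thesis ..
qed

text \<open>If \<open>norm x \<le> R\<close> and \<open>r + R < norm y\<close>, then
  \<open>r < norm (x + y)\<close>; under the product measure the two conditions are
  independent.\<close>

lemma measure_conv_norm_ge:
  fixes M N :: "'a::{real_normed_vector, second_countable_topology} measure"
  assumes M: "M \<in> borel_probs" and N: "N \<in> borel_probs"
  shows "measure M {x. norm x \<le> R} * measure N {y. r + R < norm y} \<le> measure (M \<circledast> N) {z. r < norm z}"
proof -
  interpret M: prob_space M by (rule borel_probsD[OF M])
  interpret N: prob_space N by (rule borel_probsD[OF N])
  interpret C: prob_space "M \<circledast> N" by (rule borel_probsD[OF conv_in_borel_probs[OF M N]])
  have add: "(\<lambda>y. x + y) \<in> borel_measurable borel" for x :: 'a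
    by (intro borel_measurable_continuous_onI continuous_on_add continuous_on_id continuous_on_const)
  have "emeasure N {y. r + R < norm y} * emeasure M {x. norm x \<le> R}
      = (\<integral>\<^sup>+x. emeasure N {y. r + R < norm y} * indicator {x. norm x \<le> R} x \<partial>M)"
    using norm_sets_borel by (simp add: nn_integral_cmult_indicator borel_probsD[OF M])
  also have "\<dots> \<le> (\<integral>\<^sup>+x. emeasure N {y. r < norm (x + y)} \<partial>M)"
  proof (intro nn_integral_mono)
    fix x :: 'a
    have "{y. r + R < norm y} \<subseteq> {y. r < norm (x + y)}" if "norm x \<le> R"
    proof safe
      fix y :: 'a assume "r + R < norm y"
      then show "r < norm (x + y)"
        using that norm_triangle_ineq[of "x + y" "- x"] by simp
    qed
    moreover have "{y. r < norm (x + y)} \<in> sets N"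
      using measurable_sets[OF add norm_sets_borel(1)[of r], of x] borel_probsD(2)[OF N]
      by (simp add: vimage_def)
    ultimately show "emeasure N {y. r + R < norm y} * indicator {x. norm x \<le> R} x
        \<le> emeasure N {y. r < norm (x + y)}"
      by (auto simp: indicator_def intro!: emeasure_mono)
  qed
  also have "\<dots> = emeasure (M \<circledast> N) {z. r < norm z}"
    by (simp add: emeasure_conv[OF M N norm_sets_borel(1)])
  finally have "emeasure N {y. r + R < norm y} * emeasure M {x. norm x \<le> R} \<le> emeasure (M \<circledast> N) {z. r < norm z}" .
  then show ?thesis
    by (simp add: M.emeasure_eq_measure N.emeasure_eq_measure C.emeasure_eq_measure mult.commute
        flip: ennreal_mult)
qed

text \<open>If the first factors keep half of their mass in a fixed ball, then \<open>N n\<close> cannot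
  send mass to infinity without the convolution doing so.\<close>

lemma eventually_tight_factor:
  fixes M N :: "nat \<Rightarrow> 'a::{real_normed_vector, second_countable_topology} measure"
  assumes M: "\<And>n. M n \<in> borel_probs" and N: "\<And>n. N n \<in> borel_probs"
    and half: "\<forall>\<^sub>F n in sequentially. 1 / 2 \<le> measure (M n) {x. norm x \<le> R}"
    and tight: "eventually_tight (\<lambda>n. M n \<circledast> N n)"
  shows "eventually_tight N"
  unfolding eventually_tight_def
proof (intro allI impI)
  fix \<epsilon> :: real assume "0 < \<epsilon>"
  then obtain r where "\<forall>\<^sub>F n in sequentially. measure (M n \<circledast> N n) {x. r < norm x} \<le> \<epsilon> / 2"
    using tight unfolding eventually_tight_def by (meson half_gt_zero)
  with half have "\<forall>\<^sub>F n in sequentially. measure (N n) {x. r + R < norm x} \<le> \<epsilon>"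
  proof eventually_elim
    case (elim n)
    have "1 / 2 * measure (N n) {x. r + R < norm x} \<le> measure (M n) {x. norm x \<le> R} * measure (N n) {x. r + R < norm x}"
      using elim by (intro mult_right_mono) auto
    with measure_conv_norm_ge[OF M N, of n R n r] elim show ?case by linarith
  qed
  then show "\<exists>r. \<forall>\<^sub>F n in sequentially. measure (N n) {x. r < norm x} \<le> \<epsilon>" ..
qed

text \<open>Each of the finitely many exceptional measures has a radius of its own; the maximum of
  all radii works for every \<open>n\<close>.\<close>

lemma eventually_tight_uniform:
  fixes M :: "nat \<Rightarrow> 'a::real_normed_vector measure"
  assumes "eventually_tight M" and M: "\<And>n. M n \<in> borel_probs" and "0 < \<epsilon>"
  shows "\<exists>r. \<forall>n. measure (M n) {x. r < norm x} \<le> \<epsilon>"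
proof -
  obtain r0 n0 where r0: "\<And>n. n0 \<le> n \<Longrightarrow> measure (M n) {x. r0 < norm x} \<le> \<epsilon>"
    using assms(1,3) unfolding eventually_tight_def eventually_sequentially by meson
  obtain \<rho> where \<rho>: "\<And>n. measure (M n) {x. \<rho> n < norm x} \<le> \<epsilon>"
    using ex_measure_norm_le[OF M \<open>0 < \<epsilon>\<close>] by metis
  define r where "r = Max (insert r0 (\<rho> ` {..<n0}))"
  have "measure (M n) {x. r < norm x} \<le> \<epsilon>" for n
  proof (cases "n0 \<le> n")
    case True
    have "r0 \<le> r" unfolding r_def by (intro Max_ge) auto
    from measure_norm_gr_mono[OF M this] r0[OF True] show ?thesis by (rule order_trans)
  next
    case False
    then have "\<rho> n \<le> r" unfolding r_def by (intro Max_ge) auto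
    from measure_norm_gr_mono[OF M this] \<rho> show ?thesis by (rule order_trans)
  qed
  then show ?thesis by blast
qed

text \<open>The section of the curve moves the measures to the real line, where Helly's theorem
  applies, and the curve, being continuous, moves the weak limit back.\<close>

lemma eventually_tight_weakly_convergent_subseq:
  fixes M :: "nat \<Rightarrow> (real ^ 'd) measure"
  assumes tight: "eventually_tight M" and M: "\<And>n. M n \<in> borel_probs"
  shows "\<exists>s N. strict_mono s \<and> N \<in> borel_probs \<and> weak_limit (M \<circ> s) N"
proof -
  define K where "K n = image_meas curve_section (M n)" for n
  have K: "K n \<in> borel_probs" for n
    unfolding K_def by (intro image_meas_in_borel_probs M borel_measurable_curve_section)
  then have Kd: "real_distribution (K n)" for n
    by (simp add: real_distribution_def real_distribution_axioms_def borel_probs_def)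
  have "tight K"
    unfolding tight_def
  proof (intro conjI allI impI Kd)
    fix \<epsilon> :: real assume "0 < \<epsilon>"
    then obtain r where r: "\<And>n. measure (M n) {x. r < norm x} \<le> \<epsilon> / 2"
      using eventually_tight_uniform[OF tight M, of "\<epsilon> / 2"] by auto
    \<comment> \<open>The bound \<open>2 * r + 1\<close> of \<open>curve_section_bounded\<close>,
      enlarged by 1 to stay clear of the open end of the interval; the absolute value ensures
      \<open>- b < b\<close>.\<close>
    define b where "b = 2 * \<bar>r\<bar> + 2"
    have "1 - \<epsilon> < measure (K n) {- b<..b}" for n
    proof -
      interpret prob_space "M n" by (rule borel_probsD[OF M])
      have cs: "curve_section \<in> borel_measurable (M n)"
        by (rule borel_probs_measurable[OF M borel_measurable_curve_section])
      have "1 - \<epsilon> < measure (M n) {x. norm x \<le> r}"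
        using r[of n] \<open>0 < \<epsilon>\<close> by (simp add: measure_norm_le[OF M])
      also have "\<dots> \<le> measure (M n) (curve_section -` {- b<..b} \<inter> space (M n))"
      proof (intro finite_measure_mono)
        show "{x. norm x \<le> r} \<subseteq> curve_section -` {- b<..b} \<inter> space (M n)"
          using curve_section_bounded[of _ r] by (force simp: b_def borel_probsD[OF M])
        show "curve_section -` {- b<..b} \<inter> space (M n) \<in> events"
          by (rule measurable_sets[OF cs]) simp
      qed
      also have "\<dots> = measure (K n) {- b<..b}"
        unfolding K_def image_meas_def by (subst measure_distr[OF cs]) auto
      finally show ?thesis .
    qed
    then show "\<exists>a b. a < b \<and> (\<forall>n. 1 - \<epsilon> < measure (K n) {a<..b})"
      by (intro exI[of _ "- b"] exI[of _ b]) (auto simp: b_def)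
  qed
  then obtain s L where s: "strict_mono s" and L: "real_distribution L" and conv: "weak_conv_m (K \<circ> id \<circ> s) L"
    using tight_imp_convergent_subsubsequence[of K id] by (auto simp: strict_mono_def)
  have Lp: "L \<in> borel_probs"
    using L by (simp add: real_distribution_def real_distribution_axioms_def borel_probs_def)
  have cm: "curve \<in> borel_measurable borel"
    by (intro borel_measurable_continuous_onI continuous_on_curve)
  have "weak_limit (M \<circ> s) (image_meas curve L)"
  proof (rule weak_limitI)
    fix f :: "real ^ 'd \<Rightarrow> real" and B assume f: "continuous_on UNIV f" "\<And>x. \<bar>f x\<bar> \<le> B"
    note fm = borel_measurable_continuous_onI[OF f(1)]
    have fc: "continuous_on UNIV (\<lambda>t. f (curve t))"
      by (rule continuous_on_compose2[OF f(1) continuous_on_curve]) auto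
    have "(\<lambda>n. integral\<^sup>L (K (s n)) (\<lambda>t. f (curve t))) \<longlonglongrightarrow> integral\<^sup>L L (\<lambda>t. f (curve t))"
      using Kd conv L f(2) continuous_on_eq_continuous_at[THEN iffD1, OF open_UNIV fc]
      by (intro weak_conv_imp_integral_bdd_continuous_conv[where B = B]) (auto simp: o_def)
    moreover have "integral\<^sup>L (K n) (\<lambda>t. f (curve t)) = integral\<^sup>L (M n) f" for n
      unfolding K_def
      by (subst integral_image_meas[OF M borel_measurable_curve_section borel_measurable_continuous_onI[OF fc]])
        (simp add: curve_section)
    ultimately show "(\<lambda>n. integral\<^sup>L ((M \<circ> s) n) f) \<longlonglongrightarrow> integral\<^sup>L (image_meas curve L) f"
      by (simp add: integral_image_meas[OF Lp cm fm])
  qed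
  with s image_meas_in_borel_probs[OF Lp cm] show ?thesis by blast
qed

subsection \<open>Convolution factors of a measure\<close>

text \<open>The characteristic function of the \<open>i\<close>-th marginal. Marginals suffice, as
  they serve only to recognise \<open>dirac 0\<close>.\<close>

definition coord_char :: "'d \<Rightarrow> (real ^ 'd) measure \<Rightarrow> real \<Rightarrow> complex" where
  "coord_char i M t = (CLINT x|M. iexp (t * x $ i))"

lemma borel_measurable_coord_iexp: "(\<lambda>x :: real ^ 'd. iexp (t * x $ i)) \<in> borel_measurable borel"
  by (intro borel_measurable_continuous_onI continuous_intros)

lemma coord_char_conv:
  assumes M: "M \<in> borel_probs" and N: "N \<in> borel_probs"
  shows "coord_char i (M \<circledast> N) t = coord_char i M t * coord_char i N t"
proof -
  have "coord_char i (M \<circledast> N) t = (CLINT x|M. CLINT y|N. iexp (t * x $ i) * iexp (t * y $ i))"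
    unfolding coord_char_def
    by (subst integral_conv[OF M N borel_measurable_coord_iexp, where B = 1])
       (auto simp: exp_add distrib_left)
  then show ?thesis by (simp add: coord_char_def)
qed

lemma
  assumes M: "M \<in> borel_probs"
  shows Re_coord_char: "Re (coord_char i M t) = (\<integral>x. cos (t * x $ i) \<partial>M)"
    and Im_coord_char: "Im (coord_char i M t) = (\<integral>x. sin (t * x $ i) \<partial>M)"
proof -
  have int: "integrable M (\<lambda>x. iexp (t * x $ i))"
    by (rule integrable_borel_probs[OF M borel_measurable_coord_iexp, where B = 1]) simp
  show "Re (coord_char i M t) = (\<integral>x. cos (t * x $ i) \<partial>M)" "Im (coord_char i M t) = (\<integral>x. sin (t * x $ i) \<partial>M)"
    unfolding coord_char_def integral_Re[OF int, symmetric] integral_Im[OF int, symmetric]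
    by (simp_all only: flip: cis_conv_exp) simp_all
qed

lemma coord_char_weak_limit:
  assumes "weak_limit M N" and M: "\<And>n. M n \<in> borel_probs" and N: "N \<in> borel_probs"
  shows "(\<lambda>n. coord_char i (M n) t) \<longlonglongrightarrow> coord_char i N t"
proof -
  show ?thesis
    unfolding tendsto_complex_iff Re_coord_char[OF M] Re_coord_char[OF N] Im_coord_char[OF M] Im_coord_char[OF N]
    by (intro conjI weak_limitD[OF assms(1), where B = 1] continuous_intros) auto
qed

text \<open>Near 0 the characteristic function of \<open>M\<close> does not vanish, so that of
  \<open>N\<close> equals 1 there. Its real part then says that the nonnegative function
  \<open>1 - cos (t * x $ i)\<close> has integral 0.\<close>

lemma coord_char_absorb_imp_dirac:
  fixes M N :: "(real ^ 'd) measure"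
  assumes M: "M \<in> borel_probs" and N: "N \<in> borel_probs"
    and eq: "\<And>i t. coord_char i M t = coord_char i M t * coord_char i N t"
  shows "N = dirac 0"
proof -
  interpret M: prob_space M by (rule borel_probsD[OF M])
  interpret N: prob_space N by (rule borel_probsD[OF N])
  have "AE x in N. x $ i = 0" for i
  proof -
    have "(\<lambda>n. coord_char i M (1 / Suc n)) \<longlonglongrightarrow> (CLINT x|M. iexp (0 * x $ i))"
      unfolding coord_char_def
    proof (intro integral_dominated_convergence[where w = "\<lambda>_. 1"])
      show "AE x in M. (\<lambda>n. iexp (1 / Suc n * x $ i)) \<longlonglongrightarrow> iexp (0 * x $ i)"
        by (intro AE_I2 tendsto_intros LIMSEQ_Suc[OF lim_1_over_n])
    qed (auto intro!: borel_probs_measurable[OF M] borel_measurable_coord_iexp[unfolded of_real_mult] simp: simp del: of_real_divide)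
    then have "(\<lambda>n. coord_char i M (1 / Suc n)) \<longlonglongrightarrow> 1" by (simp add: M.prob_space)
    then have "\<forall>\<^sub>F n in sequentially. coord_char i M (1 / Suc n) \<noteq> 0"
      by (rule tendsto_imp_eventually_ne) simp
    then obtain n0 where "\<And>n. n0 \<le> n \<Longrightarrow> coord_char i M (1 / Suc n) \<noteq> 0"
      by (auto simp: eventually_sequentially)
    then have one: "coord_char i N (1 / Suc n) = 1" if "n0 \<le> n" for n
      using eq[of i "1 / Suc n"] that by simp
    have ae: "AE x in N. cos (1 / Suc n * x $ i) = 1" if "n0 \<le> n" for n
    proof -
      let ?f = "\<lambda>x :: real ^ 'd. 1 - cos (1 / Suc n * x $ i)"
      have ic: "integrable N (\<lambda>x. cos (1 / Suc n * x $ i))"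
        by (rule integrable_borel_probs[OF N, where B = 1])
          (auto intro!: borel_measurable_continuous_onI continuous_intros)
      have "(\<integral>x. ?f x \<partial>N) = 0"
        using one[OF that] ic Re_coord_char[OF N, of i "1 / Suc n"] by (simp add: N.prob_space)
      then have "AE x in N. ?f x = 0"
        by (subst (asm) integral_nonneg_eq_0_iff_AE) (use ic in auto)
      then show ?thesis by auto
    qed
    \<comment> \<open>The points \<open>1 / Suc n\<close> approach 0 but are countably many, so the
      exceptional null sets can be united.\<close>
    have "AE x in N. \<forall>n\<ge>n0. cos (1 / Suc n * x $ i) = 1"
      using ae by (simp add: AE_all_countable)
    then show "AE x in N. x $ i = 0"
    proof (rule AE_mp, intro AE_I2 impI)
      fix x :: "real ^ 'd" assume c: "\<forall>n\<ge>n0. cos (1 / Suc n * x $ i) = 1"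
      obtain k :: nat where k: "\<bar>x $ i\<bar> < real k" using reals_Archimedean2 by blast
      \<comment> \<open>\<open>k\<close> makes the argument \<open>z\<close> at most 1 in absolute
        value, where \<open>cos z = 1\<close> forces \<open>z = 0\<close>; \<open>n0\<close> makes
        the hypothesis \<open>c\<close> applicable.\<close>
      define n where "n = max k n0"
      define z where "z = 1 / Suc n * x $ i"
      have "\<bar>x $ i\<bar> \<le> real (Suc n)" using k by (simp add: n_def)
      then have "\<bar>z\<bar> \<le> 1" by (simp add: z_def abs_mult field_simps)
      then have "\<bar>z\<bar> \<le> pi" using pi_gt3 by linarith
      moreover have "cos \<bar>z\<bar> = cos 0"
      proof -
        have "n0 \<le> n" by (simp add: n_def)
        then have "cos z = 1" using c unfolding z_def by blast
        then show ?thesis by (simp add: cos_abs_real)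
      qed
      ultimately have "\<bar>z\<bar> = 0"
        by (intro cos_inj_pi[of "\<bar>z\<bar>" 0] abs_ge_zero pi_ge_zero order_refl)
      then show "x $ i = 0" by (simp add: z_def)
    qed
  qed
  then have ae: "AE x in N. x = 0"
    by (simp add: vec_eq_iff AE_all_countable)
  show ?thesis
  proof (rule borel_probs_eqI[OF N dirac_in_borel_probs])
    fix F :: "(real ^ 'd) set" assume "closed F"
    then have F: "F \<in> sets borel" by (rule borel_closed)
    have "measure N F = (\<integral>x. indicator F x \<partial>N)"
      using F by (simp add: borel_probsD[OF N])
    also have "\<dots> = (\<integral>x. indicator F (0 :: real ^ 'd) \<partial>N)"
      using ae F by (intro integral_cong_AE) (auto intro!: borel_probs_measurable[OF N])
    also have "\<dots> = measure (dirac 0) F"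
      using F by (simp add: N.prob_space dirac_def measure_return)
    finally show "measure N F = measure (dirac 0) F" .
  qed
qed

subsection \<open>Concentration at a point\<close>

text \<open>Stated through neighbourhoods in a topological space, so that it covers both normed
  spaces and bi-sequences.\<close>

lemma weak_limit_diracI:
  fixes M :: "nat \<Rightarrow> 'a::topological_space measure"
  assumes M: "\<And>n. M n \<in> borel_probs"
    and out: "\<And>U. open U \<Longrightarrow> a \<in> U \<Longrightarrow> (\<lambda>n. measure (M n) (- U)) \<longlonglongrightarrow> 0"
  shows "weak_limit M (dirac a)"
proof (rule weak_limitI)
  fix f :: "'a \<Rightarrow> real" and B assume f: "continuous_on UNIV f" "\<And>x. \<bar>f x\<bar> \<le> B"
  note fm = borel_measurable_continuous_onI[OF f(1)]
  have "0 \<le> B" using f(2)[of a] by linarith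
  show "(\<lambda>n. integral\<^sup>L (M n) f) \<longlonglongrightarrow> integral\<^sup>L (dirac a) f"
  proof (rule tendstoI)
    fix \<epsilon> :: real assume "0 < \<epsilon>"
    \<comment> \<open>On \<open>U\<close> the values of \<open>f\<close> differ from
      \<open>f a\<close> by less than \<open>\<epsilon> / 2\<close>, elsewhere by at most
      \<open>2 * B\<close>, and the mass elsewhere vanishes in the limit.\<close>
    define U where "U = {x. \<bar>f x - f a\<bar> < \<epsilon> / 2}"
    have "open U" unfolding U_def
      by (intro open_Collect_less continuous_intros f(1))
    moreover have "a \<in> U" using \<open>0 < \<epsilon>\<close> by (simp add: U_def)
    ultimately have "(\<lambda>n. 2 * B * measure (M n) (- U)) \<longlonglongrightarrow> 2 * B * 0"
      by (intro tendsto_intros out)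
    then have "\<forall>\<^sub>F n in sequentially. 2 * B * measure (M n) (- U) < \<epsilon> / 2"
      using \<open>0 < \<epsilon>\<close> by (intro order_tendstoD(2)[where y = 0]) simp_all
    then show "\<forall>\<^sub>F n in sequentially. dist (integral\<^sup>L (M n) f) (integral\<^sup>L (dirac a) f) < \<epsilon>"
    proof eventually_elim
      case (elim n)
      interpret prob_space "M n" by (rule borel_probsD[OF M])
      have UM: "- U \<in> sets (M n)" using \<open>open U\<close> by (simp add: borel_probsD[OF M])
      have i: "integrable (M n) f" by (rule integrable_borel_probs[OF M fm]) (use f(2) in auto)
      have j: "integrable (M n) (\<lambda>x. 2 * B * indicat_real (- U) x)"
        using UM by (intro integrable_mult_right integrable_real_indicator) (simp_all add: emeasure_eq_measure)
      have "\<bar>integral\<^sup>L (M n) f - f a\<bar> = \<bar>\<integral>x. f x - f a \<partial>M n\<bar>"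
        using i by (simp add: prob_space)
      also have "\<dots> \<le> (\<integral>x. \<bar>f x - f a\<bar> \<partial>M n)" by (rule integral_abs_bound)
      also have "\<dots> \<le> (\<integral>x. \<epsilon> / 2 + 2 * B * indicator (- U) x \<partial>M n)"
      proof (rule integral_mono)
        fix x
        show "\<bar>f x - f a\<bar> \<le> \<epsilon> / 2 + 2 * B * indicator (- U) x"
          using f(2)[of x] f(2)[of a] \<open>0 < \<epsilon>\<close> by (cases "x \<in> U") (auto simp: U_def)
      qed (use i j in auto)
      also have "\<dots> = \<epsilon> / 2 + 2 * B * measure (M n) (- U)"
        using j UM by (simp add: prob_space)
      finally show ?case using elim by (simp add: integral_dirac[OF fm] dist_real_def)
    qed
  qed
qed

text \<open>The mean truncated distance to the best centre. The infimum makes it invariant under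
  translations, and truncation at 1 keeps the integrand bounded, so that weak convergence can be
  applied to it.\<close>

definition spread :: "'a::real_normed_vector measure \<Rightarrow> real" where
  "spread M = (INF b. \<integral>x. min 1 (norm (x - b)) \<partial>M)"

lemma borel_measurable_min_norm:
  "(\<lambda>x :: 'a::real_normed_vector. min 1 (norm (x - b))) \<in> borel_measurable borel"
  by (intro borel_measurable_continuous_onI continuous_intros)

lemma bdd_below_spread: "bdd_below (range (\<lambda>b. \<integral>x. min 1 (norm (x - b)) \<partial>M))"
  by (rule bdd_belowI2[of _ 0]) (auto intro!: integral_nonneg_AE)

lemma spread_le: "spread M \<le> (\<integral>x. min 1 (norm (x - b)) \<partial>M)"
  unfolding spread_def by (rule cINF_lower[OF bdd_below_spread]) simp

lemma spread_nonneg: "0 \<le> spread M"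
  unfolding spread_def by (rule cINF_greatest) (auto intro!: integral_nonneg_AE)

text \<open>For fixed \<open>x\<close> the distance of \<open>x + y\<close> from \<open>b\<close> is
  that of \<open>y\<close> from \<open>b - x\<close>, so its truncated mean over \<open>y\<close> is
  at least \<open>spread N\<close>; averaging over \<open>x\<close> preserves this.\<close>

lemma spread_le_spread_conv:
  fixes M N :: "'a::{real_normed_vector, second_countable_topology} measure"
  assumes M: "M \<in> borel_probs" and N: "N \<in> borel_probs"
  shows "spread N \<le> spread (M \<circledast> N)"
  unfolding spread_def[of "M \<circledast> N"]
proof (rule cINF_greatest)
  fix b :: 'a
  interpret M: prob_space M by (rule borel_probsD[OF M])
  interpret N: prob_space N by (rule borel_probsD[OF N])
  let ?f = "\<lambda>z :: 'a. min 1 (norm (z - b))"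
  have le1: "\<bar>\<integral>y. ?f (x + y) \<partial>N\<bar> \<le> 1" for x
  proof -
    have "(\<integral>y. ?f (x + y) \<partial>N) \<le> (\<integral>y. 1 \<partial>N)"
      by (intro integral_mono integrable_borel_probs[OF N, where B = 1] borel_measurable_continuous_onI continuous_intros) auto
    moreover have "0 \<le> (\<integral>y. ?f (x + y) \<partial>N)" by (intro integral_nonneg_AE) auto
    ultimately show ?thesis by (simp add: N.prob_space)
  qed
  have "spread N = (\<integral>x. spread N \<partial>M)" by (simp add: M.prob_space)
  also have "\<dots> \<le> (\<integral>x. (\<integral>y. ?f (x + y) \<partial>N) \<partial>M)"
  proof (rule integral_mono)
    show "integrable M (\<lambda>x. \<integral>y. ?f (x + y) \<partial>N)"
      using le1 by (intro integrable_borel_probs[OF M, where B = 1]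
          borel_measurable_integral_shift[OF M N borel_measurable_min_norm, where B = 1]) auto
    show "spread N \<le> (\<integral>y. ?f (x + y) \<partial>N)" for x
      using spread_le[of N "b - x"] by (simp add: algebra_simps)
  qed simp
  also have "\<dots> = (\<integral>z. ?f z \<partial>(M \<circledast> N))"
    by (rule integral_conv[OF M N borel_measurable_min_norm, where B = 1, symmetric]) auto
  finally show "spread N \<le> (\<integral>z. ?f z \<partial>(M \<circledast> N))" .
qed simp

lemma integral_min_norm_conv_dirac:
  fixes M :: "'a::{real_normed_vector, second_countable_topology} measure"
  assumes M: "M \<in> borel_probs"
  shows "(\<integral>x. min 1 (norm x) \<partial>(M \<circledast> dirac b)) = (\<integral>x. min 1 (norm (x + b)) \<partial>M)"
  unfolding conv_dirac[OF M]
  by (subst integral_image_meas[OF M]) (auto intro!: borel_measurable_continuous_onI continuous_intros)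

lemma spread_tendsto_0:
  fixes M :: "nat \<Rightarrow> 'a::{real_normed_vector, second_countable_topology} measure"
  assumes "weak_limit (\<lambda>n. M n \<circledast> dirac (b n)) (dirac 0)" and M: "\<And>n. M n \<in> borel_probs"
  shows "(\<lambda>n. spread (M n)) \<longlonglongrightarrow> 0"
proof (rule tendsto_sandwich[where f = "\<lambda>_. 0" and h = "\<lambda>n. \<integral>x. min 1 (norm x) \<partial>(M n \<circledast> dirac (b n))"])
  have "(\<lambda>n. \<integral>x. min 1 (norm x) \<partial>(M n \<circledast> dirac (b n))) \<longlonglongrightarrow> (\<integral>x. min 1 (norm x) \<partial>dirac (0 :: 'a))"
    by (rule weak_limitD[OF assms(1), where B = 1]) (auto intro!: continuous_intros)
  also have "(\<integral>x. min 1 (norm x) \<partial>dirac (0 :: 'a)) = 0"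
    by (subst integral_dirac) (auto intro!: borel_measurable_continuous_onI continuous_intros)
  finally show "(\<lambda>n. \<integral>x. min 1 (norm x) \<partial>(M n \<circledast> dirac (b n))) \<longlonglongrightarrow> 0" .
  show "\<forall>\<^sub>F n in sequentially. spread (M n) \<le> (\<integral>x. min 1 (norm x) \<partial>(M n \<circledast> dirac (b n)))"
    using spread_le[of "M _" "- b _"] by (simp add: integral_min_norm_conv_dirac[OF M])
qed (simp_all add: spread_nonneg)

text \<open>Centres are chosen optimal up to \<open>1 / Suc n\<close>, and Markov's inequality turns
  a small mean distance into small mass outside a ball.\<close>

lemma ex_centring:
  fixes M :: "nat \<Rightarrow> 'a::{real_normed_vector, second_countable_topology} measure"
  assumes lim: "(\<lambda>n. spread (M n)) \<longlonglongrightarrow> 0" and M: "\<And>n. M n \<in> borel_probs"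
  shows "\<exists>b. weak_limit (\<lambda>n. M n \<circledast> dirac (b n)) (dirac 0)"
proof -
  have "\<exists>b. (\<integral>x. min 1 (norm (x - b)) \<partial>M n) < spread (M n) + 1 / Suc n" for n
  proof -
    have "(INF b. \<integral>x. min 1 (norm (x - b)) \<partial>M n) < spread (M n) + 1 / Suc n"
      by (simp add: spread_def)
    then show ?thesis
      by (subst (asm) cINF_less_iff) (auto intro: bdd_below_spread)
  qed
  then obtain c where c: "\<And>n. (\<integral>x. min 1 (norm (x - c n)) \<partial>M n) < spread (M n) + 1 / Suc n"
    by metis
  define K where "K n = M n \<circledast> dirac (- c n)" for n
  have K: "K n \<in> borel_probs" for n
    unfolding K_def by (intro conv_in_borel_probs M dirac_in_borel_probs)
  have "(\<lambda>n. spread (M n) + 1 / Suc n) \<longlonglongrightarrow> 0 + 0"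
    by (intro tendsto_add lim LIMSEQ_Suc[OF lim_1_over_n])
  then have up: "(\<lambda>n. spread (M n) + 1 / Suc n) \<longlonglongrightarrow> 0" by simp
  have "weak_limit K (dirac 0)"
  proof (rule weak_limit_diracI[OF K])
    fix U :: "'a set" assume "open U" "0 \<in> U"
    \<comment> \<open>With \<open>\<delta> \<le> 1\<close> the truncated norm is at least
      \<open>\<delta>\<close> outside the ball, which the Markov bound below uses.\<close>
    then obtain \<delta> where \<delta>: "0 < \<delta>" "\<delta> \<le> 1" "ball 0 \<delta> \<subseteq> U"
      by (metis open_contains_ball_eq min.cobounded1 min.cobounded2 min_less_iff_conj subset_ball subset_trans zero_less_one)
    have "measure (K n) (- U) \<le> (spread (M n) + 1 / Suc n) / \<delta>" for n
    proof -
      interpret prob_space "K n" by (rule borel_probsD[OF K])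
      have Us: "- U \<in> sets (K n)" using \<open>open U\<close> by (simp add: borel_probsD[OF K])
      have ik: "integrable (K n) (\<lambda>x. min 1 (norm x))"
        by (rule integrable_borel_probs[OF K, where B = 1])
          (auto intro!: borel_measurable_continuous_onI continuous_intros)
      have "measure (K n) (- U) = (\<integral>x. indicator (- U) x \<partial>K n)"
        using Us by simp
      also have "\<dots> \<le> (\<integral>x. min 1 (norm x) / \<delta> \<partial>K n)"
      proof (rule integral_mono)
        fix x :: 'a
        show "indicat_real (- U) x \<le> min 1 (norm x) / \<delta>"
          using \<delta> by (cases "x \<in> U") (auto simp: field_simps subset_eq not_less)
      qed (use ik Us in \<open>auto simp: emeasure_eq_measure\<close>)
      also have "\<dots> = (\<integral>x. min 1 (norm (x - c n)) \<partial>M n) / \<delta>"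
        unfolding K_def by (simp add: integral_min_norm_conv_dirac[OF M])
      also have "\<dots> \<le> (spread (M n) + 1 / Suc n) / \<delta>"
        using c[of n] \<delta> by (intro divide_right_mono) auto
      finally show ?thesis .
    qed
    then have le: "\<forall>\<^sub>F n in sequentially. measure (K n) (- U) \<le> (spread (M n) + 1 / Suc n) / \<delta>"
      by (intro always_eventually allI)
    have "(\<lambda>n. (spread (M n) + 1 / Suc n) / \<delta>) \<longlonglongrightarrow> 0 / \<delta>"
      using \<delta> by (intro tendsto_divide up tendsto_const) auto
    then have "(\<lambda>n. (spread (M n) + 1 / Suc n) / \<delta>) \<longlonglongrightarrow> 0" by simp
    with le show "(\<lambda>n. measure (K n) (- U)) \<longlonglongrightarrow> 0"
      by (rule tendsto_sandwich[OF _ _ tendsto_const, rotated]) (simp add: always_eventually)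
  qed
  then show ?thesis unfolding K_def by (rule exI[of _ "\<lambda>n. - c n"])
qed

subsection \<open>Convolution chains\<close>

text \<open>After the substitution \<open>\<Lambda> k \<mapsto> \<phi>\<^sup>-\<^sup>k(\<Lambda> k)\<close> equation (E) loses the operator \<open>\<phi>\<close>.\<close>

definition conv_chain :: "(int \<Rightarrow> (real ^ 'd) measure) \<Rightarrow> (int \<Rightarrow> (real ^ 'd) measure) \<Rightarrow> bool" where
  "conv_chain \<mu> \<Lambda> \<longleftrightarrow> (\<forall>k. \<Lambda> k \<in> borel_probs) \<and> (\<forall>k. \<Lambda> k = \<mu> k \<circledast> \<Lambda> (k - 1))"

lemma conv_chainD:
  assumes "conv_chain \<mu> \<Lambda>"
  shows "\<Lambda> k \<in> borel_probs" "\<Lambda> k = \<mu> k \<circledast> \<Lambda> (k - 1)"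
  using assms unfolding conv_chain_def by blast+

text \<open>The convolution of the \<open>n\<close> measures with indices from
  \<open>k - n + 1\<close> to \<open>k\<close>; the index \<open>k - n\<close> is the first one left
  over.\<close>

primrec block :: "(int \<Rightarrow> (real ^ 'd) measure) \<Rightarrow> int \<Rightarrow> nat \<Rightarrow> (real ^ 'd) measure" where
  "block \<mu> k 0 = dirac 0"
| "block \<mu> k (Suc n) = block \<mu> k n \<circledast> \<mu> (k - int n)"

lemma conv_left_commute:
  fixes L M N :: "'a::ordered_euclidean_space measure"
  assumes "L \<in> borel_probs" "M \<in> borel_probs" "N \<in> borel_probs"
  shows "L \<circledast> (M \<circledast> N) = M \<circledast> (L \<circledast> N)"
  using assms by (metis conv_assoc conv_commute)

lemma dirac_conv_dirac: "dirac a \<circledast> dirac b = dirac (a + b :: 'a::{second_countable_topology, topological_monoid_add})"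
  unfolding conv_dirac[OF dirac_in_borel_probs]
  by (intro image_meas_dirac borel_measurable_continuous_onI continuous_intros)

lemma conv_shift_both:
  fixes M N :: "'a::ordered_euclidean_space measure"
  assumes M: "M \<in> borel_probs" and N: "N \<in> borel_probs"
  shows "(M \<circledast> dirac (- b)) \<circledast> (N \<circledast> dirac b) = M \<circledast> N"
proof -
  note d = dirac_in_borel_probs
  have "(M \<circledast> dirac (- b)) \<circledast> (N \<circledast> dirac b) = M \<circledast> (N \<circledast> (dirac (- b) \<circledast> dirac b))"
    by (simp add: conv_assoc conv_left_commute[of "dirac (- b)"] M N d conv_in_borel_probs)
  then show ?thesis by (simp add: dirac_conv_dirac conv_dirac_0 N)
qed

lemma block_in_borel_probs: "(\<And>k. \<mu> k \<in> borel_probs) \<Longrightarrow> block \<mu> k n \<in> borel_probs"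
  by (induction n) (auto intro: dirac_in_borel_probs conv_in_borel_probs)

text \<open>A block grows at its lower end by definition. Growth at the upper end is what links
  neighbouring values of \<open>k\<close> in the construction of a chain.\<close>

lemma block_Suc_left:
  assumes "\<And>k. \<mu> k \<in> borel_probs"
  shows "block \<mu> k (Suc n) = \<mu> k \<circledast> block \<mu> (k - 1) n"
proof (induction n)
  case 0
  then show ?case
    by (simp add: conv_commute[OF dirac_in_borel_probs] assms)
next
  case (Suc n)
  then have "block \<mu> k (Suc (Suc n)) = (\<mu> k \<circledast> block \<mu> (k - 1) n) \<circledast> \<mu> (k - 1 - int n)"
    by (simp add: algebra_simps)
  then show ?case
    by (simp add: conv_assoc assms block_in_borel_probs)
qed

lemma conv_chain_block:
  assumes "\<And>k. \<mu> k \<in> borel_probs" "conv_chain \<mu> \<Lambda>"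
  shows "\<Lambda> k = block \<mu> k n \<circledast> \<Lambda> (k - int n)"
proof -
  note \<Lambda>p = conv_chainD(1)[OF assms(2)] and rec = conv_chainD(2)[OF assms(2)]
  show ?thesis
  proof (induction n)
    case 0
    show ?case
      by (simp add: conv_commute[OF dirac_in_borel_probs \<Lambda>p] conv_dirac_0 \<Lambda>p)
  next
    case (Suc n)
    have "k - int n - 1 = k - int (Suc n)" by simp
    then have "block \<mu> k n \<circledast> \<Lambda> (k - int n) = block \<mu> k n \<circledast> (\<mu> (k - int n) \<circledast> \<Lambda> (k - int (Suc n)))"
      using rec[of "k - int n"] by metis
    also have "\<dots> = block \<mu> k (Suc n) \<circledast> \<Lambda> (k - int (Suc n))"
      by (simp add: conv_assoc block_in_borel_probs assms(1) \<Lambda>p)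
    finally show ?case using Suc by simp
  qed
qed

text \<open>Any two chains satisfy \<open>\<Lambda> k \<circledast> N (-n) = N k \<circledast> \<Lambda> (-n)\<close>, and the right hand side converges
  to \<open>N k\<close> once \<open>\<Lambda> (-n)\<close> is centred.\<close>

lemma conv_chain_factor:
  fixes \<mu> :: "int \<Rightarrow> (real ^ 'd) measure"
  assumes \<mu>: "\<And>k. \<mu> k \<in> borel_probs" and \<Lambda>: "conv_chain \<mu> \<Lambda>" and N: "conv_chain \<mu> N"
    and lim: "weak_limit (\<lambda>n. \<Lambda> (- int n) \<circledast> dirac (b n)) (dirac 0)"
  shows "\<exists>\<nu>\<in>borel_probs. \<forall>k. N k = \<Lambda> k \<circledast> \<nu>"
proof -
  note d = dirac_in_borel_probs
  have \<Lambda>p: "\<Lambda> k \<in> borel_probs" and Np: "N k \<in> borel_probs" for k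
    using conv_chainD(1)[OF \<Lambda>] conv_chainD(1)[OF N] by auto
  define \<rho> where "\<rho> n = N (- int n) \<circledast> dirac (b n)" for n
  define \<sigma> where "\<sigma> n = \<Lambda> (- int n) \<circledast> dirac (b n)" for n
  have \<rho>p: "\<rho> n \<in> borel_probs" and \<sigma>p: "\<sigma> n \<in> borel_probs" for n
    by (simp_all add: \<rho>_def \<sigma>_def conv_in_borel_probs Np \<Lambda>p d)
  have swap: "\<forall>\<^sub>F n in sequentially. N k \<circledast> \<sigma> n = \<Lambda> k \<circledast> \<rho> n" for k
  \<comment> \<open>From here on the block of length \<open>k + n\<close> reaches from
    \<open>k\<close> exactly down to \<open>- n + 1\<close>, and both sides are that block convolved
    with \<open>N (- int n)\<close>, \<open>\<Lambda> (- int n)\<close> and the shift by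
    \<open>b n\<close>.\<close>
  proof (rule eventually_sequentiallyI[of "nat (- k)"])
    fix n assume "nat (- k) \<le> n"
    then have kn: "k - int (nat (k + int n)) = - int n" by simp
    let ?B = "block \<mu> k (nat (k + int n))"
    have B: "?B \<in> borel_probs" by (rule block_in_borel_probs[of \<mu>, OF \<mu>])
    have "N k = ?B \<circledast> N (- int n)" "\<Lambda> k = ?B \<circledast> \<Lambda> (- int n)"
      using conv_chain_block[of \<mu>, OF \<mu> N, of k "nat (k + int n)"] conv_chain_block[of \<mu>, OF \<mu> \<Lambda>, of k "nat (k + int n)"]
      by (simp_all only: kn)
    then show "N k \<circledast> \<sigma> n = \<Lambda> k \<circledast> \<rho> n"
      by (simp add: \<rho>_def \<sigma>_def conv_assoc B Np \<Lambda>p d conv_in_borel_probs conv_left_commute[of "N (- int n)" "\<Lambda> (- int n)"])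
  qed
  have limN: "weak_limit (\<lambda>n. N k \<circledast> \<sigma> n) (N k)" for k
    using weak_limit_conv[OF lim[folded \<sigma>_def] Np \<sigma>p d] by (simp add: conv_dirac_0 Np)
  have "eventually_tight (\<lambda>n. N 0 \<circledast> \<sigma> n)"
    by (rule eventually_tightI_weak_limit[OF limN conv_in_borel_probs[OF Np \<sigma>p] Np])
  then have "eventually_tight (\<lambda>n. \<Lambda> 0 \<circledast> \<rho> n)"
    by (rule eventually_tight_cong[OF _ swap])
  moreover obtain r where r: "\<forall>\<^sub>F n::nat in sequentially. 1 / 2 \<le> measure (\<Lambda> 0) {x. norm x \<le> r}"
    using eventually_tight_half[OF eventually_tightI_weak_limit[OF weak_limit_const \<Lambda>p \<Lambda>p] \<Lambda>p] by blast
  ultimately have "eventually_tight \<rho>"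
    using eventually_tight_factor[where M = "\<lambda>_. \<Lambda> 0", OF \<Lambda>p \<rho>p r] by simp
  \<comment> \<open>Tightness at index 0 provides one subsequence and one limit for all
    \<open>k\<close>, because \<open>\<rho>\<close> does not depend on \<open>k\<close>.\<close>
  then obtain s \<nu> where s: "strict_mono s" and \<nu>: "\<nu> \<in> borel_probs" "weak_limit (\<rho> \<circ> s) \<nu>"
    using eventually_tight_weakly_convergent_subseq \<rho>p by blast
  have "N k = \<Lambda> k \<circledast> \<nu>" for k
  proof (rule weak_limit_unique)
    have "weak_limit (\<lambda>n. \<Lambda> k \<circledast> \<rho> n) (N k)"
      by (rule weak_limit_cong[OF limN swap])
    then show "weak_limit (\<lambda>n. \<Lambda> k \<circledast> \<rho> (s n)) (N k)"
      using weak_limit_subseq[OF _ s] by (simp add: o_def)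
    show "weak_limit (\<lambda>n. \<Lambda> k \<circledast> \<rho> (s n)) (\<Lambda> k \<circledast> \<nu>)"
      using \<nu> by (intro weak_limit_conv \<Lambda>p \<rho>p) (simp_all add: o_def)
  qed (simp_all add: Np \<Lambda>p \<nu> conv_in_borel_probs)
  with \<nu> show ?thesis by blast
qed

text \<open>The convolution gives \<open>A\<close> the \<open>M\<close>-average of the masses that
  \<open>N\<close> gives to translates of \<open>A\<close>, so some translate has at least the
  average.\<close>

lemma ex_translate_measure_gr:
  fixes M N :: "'a::{second_countable_topology, topological_monoid_add} measure"
  assumes M: "M \<in> borel_probs" and N: "N \<in> borel_probs" and A: "A \<in> sets borel"
    and c: "0 \<le> c" "c < measure (M \<circledast> N) A"
  shows "\<exists>x. c < measure N {y. x + y \<in> A}"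
proof (rule ccontr)
  assume "\<nexists>x. c < measure N {y. x + y \<in> A}"
  then have le: "measure N {y. x + y \<in> A} \<le> c" for x by (simp add: not_less)
  interpret M: prob_space M by (rule borel_probsD[OF M])
  interpret N: prob_space N by (rule borel_probsD[OF N])
  interpret C: prob_space "M \<circledast> N" by (rule borel_probsD[OF conv_in_borel_probs[OF M N]])
  have "emeasure (M \<circledast> N) A \<le> (\<integral>\<^sup>+x. ennreal c \<partial>M)"
    unfolding emeasure_conv[OF M N A]
    by (intro nn_integral_mono) (simp add: N.emeasure_eq_measure ennreal_leI le)
  then show False
    using c by (simp add: M.emeasure_space_1 C.emeasure_eq_measure)
qed

lemma conv_chain_ex_centred:
  fixes \<mu> :: "int \<Rightarrow> (real ^ 'd) measure"
  assumes \<mu>: "\<And>k. \<mu> k \<in> borel_probs" and N: "conv_chain \<mu> N"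
  shows "\<exists>\<Lambda> b. conv_chain \<mu> \<Lambda> \<and> weak_limit (\<lambda>n. \<Lambda> (- int n) \<circledast> dirac (b n)) (dirac 0)"
proof -
  note d = dirac_in_borel_probs and B = block_in_borel_probs[of \<mu>, OF \<mu>]
  note Np = conv_chainD(1)[OF N]
  interpret N0: prob_space "N 0" by (rule borel_probsD[OF Np])
  \<comment> \<open>The bound 1/4 leaves mass 3/4 in the ball, hence a strict inequality against
    1/2.\<close>
  obtain R where "measure (N 0) {x. R < norm x} \<le> 1 / 4"
    using ex_measure_norm_le[OF Np, of "1 / 4" 0] by auto
  then have R: "1 / 2 < measure (N 0) {x. norm x \<le> R}"
    by (simp add: measure_norm_le[OF Np])
  \<comment> \<open>\<open>N 0\<close> is a block convolved with \<open>N (- int n)\<close>, so the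
    same radius \<open>R\<close> serves every \<open>n\<close> after a translation.\<close>
  have "\<exists>a. 1 / 2 < measure (N (- int n)) {y. norm (a + y) \<le> R}" for n
    using ex_translate_measure_gr[OF B[of 0 n] Np[of "- int n"] norm_sets_borel(2)[of R], where c = "1 / 2"] R
      conv_chain_block[of \<mu>, OF \<mu> N, of 0 n] by simp
  then obtain a where a: "\<And>n. 1 / 2 < measure (N (- int n)) {y. norm (a n + y) \<le> R}"
    by metis
  define \<beta> where "\<beta> n = N (- int n) \<circledast> dirac (a n)" for n
  \<comment> \<open>The shift is opposite to that in \<open>\<beta> n\<close>, so
    \<open>\<alpha> m n \<circledast> \<beta> n\<close> is \<open>N (- int m)\<close> once
    \<open>m \<le> n\<close>.\<close>
  define \<alpha> where "\<alpha> m n = block \<mu> (- int m) (n - m) \<circledast> dirac (- a n)" for m n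
  have \<beta>p: "\<beta> n \<in> borel_probs" and \<alpha>p: "\<alpha> m n \<in> borel_probs" for m n
    by (simp_all add: \<alpha>_def \<beta>_def conv_in_borel_probs B Np d)
  have half: "1 / 2 \<le> measure (\<beta> n) {x. norm x \<le> R}" for n
  proof -
    have m: "(\<lambda>x. x + a n) \<in> borel_measurable borel"
      by (intro borel_measurable_continuous_onI continuous_intros)
    have "measure (\<beta> n) {x. norm x \<le> R} = measure (N (- int n)) ((\<lambda>x. x + a n) -` {x. norm x \<le> R} \<inter> space (N (- int n)))"
      unfolding \<beta>_def conv_dirac[OF Np] image_meas_def
      by (rule measure_distr[OF borel_probs_measurable[OF Np m] norm_sets_borel(2)])
    then show ?thesis
      using a[of n] by (simp add: borel_probsD[OF Np] vimage_def add.commute)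
  qed
  have tight_\<alpha>: "eventually_tight (\<alpha> m)" for m
  proof (rule eventually_tight_factor[OF \<beta>p \<alpha>p])
    show "\<forall>\<^sub>F n in sequentially. 1 / 2 \<le> measure (\<beta> n) {x. norm x \<le> R}"
      using half by simp
    have "\<forall>\<^sub>F n in sequentially. N (- int m) = \<beta> n \<circledast> \<alpha> m n"
    proof (rule eventually_sequentiallyI[of m])
      fix n assume "m \<le> n"
      then have "N (- int m) = block \<mu> (- int m) (n - m) \<circledast> N (- int n)"
        using conv_chain_block[of \<mu>, OF \<mu> N, of "- int m" "n - m"] by (simp add: of_nat_diff)
      also have "\<dots> = \<alpha> m n \<circledast> \<beta> n"
        unfolding \<alpha>_def \<beta>_def by (rule conv_shift_both[symmetric]) (rule B Np)+
      finally show "N (- int m) = \<beta> n \<circledast> \<alpha> m n"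
        by (simp add: conv_commute[OF \<alpha>p \<beta>p])
    qed
    then show "eventually_tight (\<lambda>n. \<beta> n \<circledast> \<alpha> m n)"
      by (rule eventually_tight_cong[rotated]) (rule eventually_tightI_weak_limit[OF weak_limit_const Np Np])
  qed
  define P where "P m s \<longleftrightarrow> (\<exists>L\<in>borel_probs. weak_limit (\<alpha> m \<circ> s) L)" for m s
  interpret subseqs P
  proof
    fix m :: nat and s :: "nat \<Rightarrow> nat" assume "strict_mono s"
    from eventually_tight_weakly_convergent_subseq[OF eventually_tight_subseq[OF tight_\<alpha> this], of m]
    show "\<exists>r. strict_mono r \<and> P m (s \<circ> r)"
      unfolding P_def by (auto simp: \<alpha>p o_assoc)
  qed
  have "\<exists>L\<in>borel_probs. weak_limit (\<lambda>n. \<alpha> m (diagseq n)) L" for m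
  proof -
    \<comment> \<open>The diagonal sequence is a subsequence of the \<open>m\<close>-th extracted
      one only from index \<open>Suc m\<close> on; the offset is removed afterwards.\<close>
    have "P m (diagseq \<circ> ((+) (Suc m)))"
      by (rule diagseq_holds) (auto simp: P_def o_assoc intro: weak_limit_subseq)
    then obtain L where L: "L \<in> borel_probs" "weak_limit (\<lambda>n. \<alpha> m (diagseq (n + Suc m))) L"
      by (auto simp: P_def o_def add.commute)
    have "weak_limit (\<lambda>n. \<alpha> m (diagseq n)) L"
      unfolding weak_limit_def
    proof (intro allI impI)
      fix f :: "real ^ 'd \<Rightarrow> real" assume "continuous_on UNIV f" "bounded (range f)"
      with L(2) have "(\<lambda>n. integral\<^sup>L (\<alpha> m (diagseq (n + Suc m))) f) \<longlonglongrightarrow> integral\<^sup>L L f"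
        by (simp add: weak_limit_def)
      then show "(\<lambda>n. integral\<^sup>L (\<alpha> m (diagseq n)) f) \<longlonglongrightarrow> integral\<^sup>L L f"
        by (rule LIMSEQ_offset)
    qed
    with L show ?thesis by blast
  qed
  then obtain L where Lp: "\<And>m. L m \<in> borel_probs" and Llim: "\<And>m. weak_limit (\<lambda>n. \<alpha> m (diagseq n)) (L m)"
    by metis
  have Lrec: "L m = \<mu> (- int m) \<circledast> L (Suc m)" for m
  proof (rule weak_limit_unique[OF Llim])
    \<comment> \<open>The shift \<open>a n\<close> is common to all \<open>m\<close>, so peeling off
      the top factor turns \<open>\<alpha> m n\<close> into \<open>\<alpha> (Suc m) n\<close>
      exactly.\<close>
    have ev: "\<mu> (- int m) \<circledast> \<alpha> (Suc m) (diagseq n) = \<alpha> m (diagseq n)" if "Suc m \<le> n" for n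
    proof -
      have "Suc m \<le> diagseq n"
        using that seq_suble[OF subseq_diagseq, of n] by linarith
      then have "diagseq n - m = Suc (diagseq n - Suc m)" "- int (Suc m) = - int m - 1" by simp_all
      then show ?thesis
        unfolding \<alpha>_def
        by (simp only: block_Suc_left[of \<mu>, OF \<mu>] conv_assoc[OF \<mu> B d])
    qed
    show "weak_limit (\<lambda>n. \<alpha> m (diagseq n)) (\<mu> (- int m) \<circledast> L (Suc m))"
      by (rule weak_limit_cong[OF weak_limit_conv[OF Llim \<mu> \<alpha>p Lp] eventually_sequentiallyI[of "Suc m"]]) (rule ev)
  qed (simp_all add: Lp conv_in_borel_probs \<mu>)
  \<comment> \<open>For \<open>k \<le> 0\<close> the block is empty and the value is
    \<open>L (- k)\<close>; for \<open>k > 0\<close> the second factor is \<open>L 0\<close>,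
    extended upwards by the block.\<close>
  define \<Lambda> where "\<Lambda> k = block \<mu> k (nat k) \<circledast> L (nat (- k))" for k
  have \<Lambda>L: "\<Lambda> (- int n) = L n" for n
  proof -
    have "nat (- int n) = 0" by simp
    then show ?thesis by (simp add: \<Lambda>_def conv_commute[OF d Lp] conv_dirac_0 Lp)
  qed
  have chain: "conv_chain \<mu> \<Lambda>"
    unfolding conv_chain_def
  proof safe
    fix k
    show "\<Lambda> k \<in> borel_probs" by (simp add: \<Lambda>_def conv_in_borel_probs B Lp)
    show "\<Lambda> k = \<mu> k \<circledast> \<Lambda> (k - 1)"
    proof (cases "k \<le> 0")
      case True
      then obtain n where "k = - int n" by (metis nonpos_int_cases)
      moreover from this have "k - 1 = - int (Suc n)" by simp
      ultimately show ?thesis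
        using Lrec[of n] by (simp only: \<Lambda>L)
    next
      case False
      then have "nat k = Suc (nat (k - 1))" "nat (- k) = nat (- (k - 1))" by simp_all
      then show ?thesis
        unfolding \<Lambda>_def by (simp only: block_Suc_left[of \<mu>, OF \<mu>] conv_assoc[OF \<mu> B Lp])
    qed
  qed
  \<comment> \<open>The shift cancels the one in \<open>\<alpha> 0 n\<close>. Tightness of
    \<open>\<alpha> 0\<close> and of the constant \<open>L 0\<close> then forces tightness of
    \<open>\<sigma>\<close>.\<close>
  define \<sigma> where "\<sigma> n = L n \<circledast> dirac (a n)" for n
  have \<sigma>p: "\<sigma> n \<in> borel_probs" for n
    by (simp add: \<sigma>_def conv_in_borel_probs Lp d)
  have L0: "L 0 = \<alpha> 0 n \<circledast> \<sigma> n" for n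
    using conv_chain_block[of \<mu>, OF \<mu> chain, of 0 n] \<Lambda>L[of 0] \<Lambda>L[of n]
    by (simp add: \<alpha>_def \<sigma>_def conv_shift_both B Lp)
  obtain r where "\<forall>\<^sub>F n in sequentially. 1 / 2 \<le> measure (\<alpha> 0 n) {x. norm x \<le> r}"
    using eventually_tight_half[OF tight_\<alpha> \<alpha>p] by blast
  moreover have "eventually_tight (\<lambda>n. \<alpha> 0 n \<circledast> \<sigma> n)"
    unfolding L0[symmetric] by (rule eventually_tightI_weak_limit[OF weak_limit_const Lp Lp])
  ultimately have "eventually_tight \<sigma>"
    by (rule eventually_tight_factor[OF \<alpha>p \<sigma>p])
  then obtain s \<kappa> where s: "strict_mono s" and \<kappa>: "\<kappa> \<in> borel_probs" "weak_limit (\<sigma> \<circ> diagseq \<circ> s) \<kappa>"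
    using eventually_tight_weakly_convergent_subseq[OF eventually_tight_subseq[OF _ subseq_diagseq], of \<sigma>] \<sigma>p
    by auto
  have "\<kappa> = dirac 0"
  proof (rule coord_char_absorb_imp_dirac[OF Lp[of 0] \<kappa>(1)])
    fix i t
    \<comment> \<open>The products are constantly \<open>coord_char i (L 0) t\<close>, whereas the
      first factors also converge to that value.\<close>
    have "(\<lambda>n. coord_char i (\<alpha> 0 (diagseq (s n))) t * coord_char i (\<sigma> (diagseq (s n))) t)
        \<longlonglongrightarrow> coord_char i (L 0) t * coord_char i \<kappa> t"
      using weak_limit_subseq[OF Llim s] \<kappa> by (intro tendsto_mult coord_char_weak_limit \<alpha>p \<sigma>p Lp) (simp_all add: o_def)
    then have "(\<lambda>n. coord_char i (L 0) t) \<longlonglongrightarrow> coord_char i (L 0) t * coord_char i \<kappa> t"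
      by (simp add: coord_char_conv[OF \<alpha>p \<sigma>p, symmetric] L0[symmetric])
    then show "coord_char i (L 0) t = coord_char i (L 0) t * coord_char i \<kappa> t"
      by (rule LIMSEQ_unique[OF tendsto_const])
  qed
  then have "weak_limit (\<lambda>n. L (diagseq (s n)) \<circledast> dirac (a (diagseq (s n)))) (dirac 0)"
    using \<kappa>(2) by (simp add: o_def \<sigma>_def)
  then have sub: "(\<lambda>n. spread (L (diagseq (s n)))) \<longlonglongrightarrow> 0"
    by (rule spread_tendsto_0) (rule Lp)
  \<comment> \<open>\<open>L (Suc n)\<close> is a convolution factor of \<open>L n\<close>;
    monotonicity extends the limit from the subsequence to all \<open>n\<close>.\<close>
  have "decseq (\<lambda>n. spread (L n))"
    using spread_le_spread_conv[OF \<mu> Lp] Lrec by (intro decseq_SucI) metis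
  have "(\<lambda>n. spread (L n)) \<longlonglongrightarrow> 0"
  proof (rule order_tendstoI)
    fix y :: real assume "0 < y"
    then obtain n where n: "spread (L (diagseq (s n))) < y"
      using order_tendstoD(2)[OF sub, of y] by (auto simp: eventually_sequentially)
    have "spread (L k) < y" if "diagseq (s n) \<le> k" for k
      using decseqD[OF \<open>decseq (\<lambda>n. spread (L n))\<close> that] n by linarith
    then show "\<forall>\<^sub>F n in sequentially. spread (L n) < y"
      unfolding eventually_sequentially by blast
  qed (auto intro: always_eventually less_le_trans[OF _ spread_nonneg])
  \<comment> \<open>New centres: the \<open>a n\<close> are known to work only along the
    subsequence.\<close>
  then obtain b where "weak_limit (\<lambda>n. L n \<circledast> dirac (b n)) (dirac 0)"
    using ex_centring Lp by blast
  then have "weak_limit (\<lambda>n. \<Lambda> (- int n) \<circledast> dirac (b n)) (dirac 0)"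
    by (simp add: \<Lambda>L)
  with chain show ?thesis by blast
qed

subsection \<open>Product measures on the space of bi-sequences\<close>

text \<open>Makes the convolution lemmas above available on bi-sequences.\<close>

instance "fun" :: (type, topological_monoid_add) topological_monoid_add
proof
  fix f g :: "'a \<Rightarrow> 'b"
  have "continuous_on UNIV (\<lambda>p :: ('a \<Rightarrow> 'b) \<times> ('a \<Rightarrow> 'b). fst p + snd p)"
  proof (rule continuous_on_coordinatewise_then_product)
    fix i :: 'a
    have "continuous_on UNIV (\<lambda>p :: ('a \<Rightarrow> 'b) \<times> ('a \<Rightarrow> 'b). fst p i + snd p i)"
      by (intro continuous_on_add continuous_on_product_then_coordinatewise[OF continuous_on_fst]
          continuous_on_product_then_coordinatewise[OF continuous_on_snd] continuous_on_id)
    then show "continuous_on UNIV (\<lambda>p :: ('a \<Rightarrow> 'b) \<times> ('a \<Rightarrow> 'b). (fst p + snd p) i)"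
      by simp
  qed
  note cont = this
  show "LIM x nhds f \<times>\<^sub>F nhds g. fst x + snd x :> nhds (f + g)"
    unfolding nhds_prod[symmetric]
  proof (rule topological_tendstoI)
    fix S assume "open S" "f + g \<in> S"
    then show "\<forall>\<^sub>F p in nhds (f, g). fst p + snd p \<in> S"
      using open_vimage[OF \<open>open S\<close> cont] by (auto simp: eventually_nhds)
  qed
qed

lemma cylinder_eq_prod_emb:
  assumes "\<And>k. \<alpha> k \<in> borel_probs"
  shows "prod_emb UNIV \<alpha> J (Pi\<^sub>E J X) = {v. \<forall>k\<in>J. v k \<in> X k}"
  using borel_probsD(3)[OF assms] by (auto simp: prod_emb_def PiE_iff)

lemma emeasure_product_meas_cylinder:
  fixes \<alpha> :: "int \<Rightarrow> 'a::second_countable_topology measure"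
  assumes \<alpha>: "\<And>k. \<alpha> k \<in> borel_probs" and "finite J" "\<And>k. k \<in> J \<Longrightarrow> X k \<in> sets borel"
  shows "emeasure (product_meas \<alpha>) {v. \<forall>k\<in>J. v k \<in> X k} = (\<Prod>k\<in>J. emeasure (\<alpha> k) (X k))"
  unfolding product_meas_def cylinder_eq_prod_emb[of \<alpha>, OF \<alpha>, symmetric]
  by (rule emeasure_PiM_emb) (use assms borel_probsD(1,2)[OF \<alpha>] in auto)

lemma product_meas_eqI:
  fixes \<alpha> :: "int \<Rightarrow> 'a::second_countable_topology measure"
  assumes \<alpha>: "\<And>k. \<alpha> k \<in> borel_probs" and L: "L \<in> borel_probs"
    and eq: "\<And>J X. finite J \<Longrightarrow> (\<And>k. X k \<in> sets borel) \<Longrightarrow>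
      emeasure L {v. \<forall>k\<in>J. v k \<in> X k} = (\<Prod>k\<in>J. emeasure (\<alpha> k) (X k))"
  shows "L = product_meas \<alpha>"
  unfolding product_meas_def
proof -
  interpret prob_space "\<alpha> k" for k by (rule borel_probsD[OF \<alpha>])
  interpret product_prob_space \<alpha> UNIV by unfold_locales
  show "L = PiM UNIV \<alpha>"
  proof (rule PiM_eq)
    show "sets L = sets (PiM UNIV \<alpha>)"
      using borel_probsD(2)[OF product_meas_in_borel_probs[of \<alpha>, OF \<alpha>]] borel_probsD(2)[OF L]
      by (simp add: product_meas_def)
    fix J X assume J: "finite J" and X: "\<And>k. k \<in> J \<Longrightarrow> X k \<in> sets (\<alpha> k)"
    \<comment> \<open>\<open>X\<close> is measurable on \<open>J\<close> only, while
      \<open>eq\<close> asks for measurability at every index; the empty set is a harmless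
      filler.\<close>
    define Y where "Y k = (if k \<in> J then X k else {})" for k
    have "emeasure L {v. \<forall>k\<in>J. v k \<in> Y k} = (\<Prod>k\<in>J. emeasure (\<alpha> k) (Y k))"
      using X by (intro eq J) (auto simp: Y_def borel_probsD(2)[OF \<alpha>])
    then show "emeasure L (prod_emb UNIV \<alpha> J (Pi\<^sub>E J X)) = (\<Prod>k\<in>J. emeasure (\<alpha> k) (X k))"
      by (simp add: cylinder_eq_prod_emb[of \<alpha>, OF \<alpha>] Y_def)
  qed
qed

lemma cylinder_sets_borel:
  fixes X :: "int \<Rightarrow> 'a::second_countable_topology set"
  assumes "finite J" "\<And>k. X k \<in> sets borel"
  shows "{v. \<forall>k\<in>J. v k \<in> X k} \<in> sets borel"
proof -
  have c: "(\<lambda>v :: int \<Rightarrow> 'a. v k) \<in> borel_measurable borel" for k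
    by (intro borel_measurable_continuous_onI continuous_on_product_then_coordinatewise[OF continuous_on_id])
  have "{v. v k \<in> X k} \<in> sets borel" for k
    using measurable_sets[OF c assms(2), of k] by (simp add: vimage_def)
  then have "(\<Inter>k\<in>J. {v. v k \<in> X k}) \<in> sets borel" if "J \<noteq> {}"
    using assms(1) that by (intro sets.finite_INT) auto
  moreover have "(\<Inter>k\<in>J. {v. v k \<in> X k}) = {v. \<forall>k\<in>J. v k \<in> X k}" by auto
  ultimately show ?thesis by (cases "J = {}") auto
qed

text \<open>The integrand depends on the coordinates in \<open>J\<close> only, so the integral can
  be taken over the finite product.\<close>

lemma nn_integral_product_meas_prod:
  fixes \<alpha> :: "int \<Rightarrow> 'a::second_countable_topology measure"
  assumes \<alpha>: "\<And>k. \<alpha> k \<in> borel_probs" and J: "finite J"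
    and g: "\<And>k. g k \<in> borel_measurable borel"
  shows "(\<integral>\<^sup>+v. (\<Prod>k\<in>J. g k (v k)) \<partial>product_meas \<alpha>) = (\<Prod>k\<in>J. \<integral>\<^sup>+x. g k x \<partial>\<alpha> k)"
proof -
  interpret prob_space "\<alpha> k" for k by (rule borel_probsD[OF \<alpha>])
  interpret product_prob_space \<alpha> UNIV by unfold_locales
  have gm: "g k \<in> borel_measurable (\<alpha> k)" for k by (rule borel_probs_measurable[OF \<alpha> g])
  have res: "(\<lambda>v. restrict v J) \<in> measurable (PiM UNIV \<alpha>) (PiM J \<alpha>)"
    by (rule measurable_restrict_subset) simp
  have pm: "(\<lambda>v. \<Prod>k\<in>J. g k (v k)) \<in> borel_measurable (PiM J \<alpha>)"
    using gm by (intro borel_measurable_prod_ennreal measurable_compose[OF measurable_component_singleton]) auto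
  have "(\<integral>\<^sup>+v. (\<Prod>k\<in>J. g k (v k)) \<partial>PiM UNIV \<alpha>) = (\<integral>\<^sup>+v. (\<Prod>k\<in>J. g k (restrict v J k)) \<partial>PiM UNIV \<alpha>)"
    by (intro nn_integral_cong prod.cong) auto
  also have "\<dots> = (\<integral>\<^sup>+v. (\<Prod>k\<in>J. g k (v k)) \<partial>distr (PiM UNIV \<alpha>) (PiM J \<alpha>) (\<lambda>v. restrict v J))"
    by (rule nn_integral_distr[OF res, symmetric]) (simp add: pm)
  also have "\<dots> = (\<Prod>k\<in>J. \<integral>\<^sup>+x. g k x \<partial>\<alpha> k)"
    unfolding distr_PiM_restrict_finite[OF J subset_UNIV] by (rule product_nn_integral_prod[OF J gm])
  finally show ?thesis by (simp add: product_meas_def)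
qed

text \<open>On a cylinder the inner integral of the convolution factors into functions of single
  coordinates, and independence under \<open>product_meas \<alpha>\<close> factors the outer
  one.\<close>

lemma product_meas_conv:
  fixes \<alpha> \<beta> :: "int \<Rightarrow> 'a::{second_countable_topology, topological_monoid_add} measure"
  assumes \<alpha>: "\<And>k. \<alpha> k \<in> borel_probs" and \<beta>: "\<And>k. \<beta> k \<in> borel_probs"
  shows "product_meas \<alpha> \<circledast> product_meas \<beta> = product_meas (\<lambda>k. \<alpha> k \<circledast> \<beta> k)"
proof (rule product_meas_eqI)
  note P = product_meas_in_borel_probs[of \<alpha>, OF \<alpha>] product_meas_in_borel_probs[of \<beta>, OF \<beta>]
  show "\<alpha> k \<circledast> \<beta> k \<in> borel_probs" for k by (rule conv_in_borel_probs[OF \<alpha> \<beta>])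
  show "product_meas \<alpha> \<circledast> product_meas \<beta> \<in> borel_probs" by (rule conv_in_borel_probs[OF P])
  fix J :: "int set" and X :: "int \<Rightarrow> 'a set" assume J: "finite J" and X: "\<And>k. X k \<in> sets borel"
  have "(\<lambda>y. x + y) \<in> borel_measurable borel" for x :: 'a
    by (intro borel_measurable_continuous_onI continuous_on_add continuous_on_const continuous_on_id)
  then have shift: "{y. x + y \<in> X k} \<in> sets borel" for x k
    using measurable_sets[OF _ X] by (fastforce simp: vimage_def)
  have meas: "(\<lambda>x. emeasure (\<beta> k) {y. x + y \<in> X k}) \<in> borel_measurable borel" for k
  proof -
    interpret N: prob_space "\<beta> k" by (rule borel_probsD[OF \<beta>])
    have "(\<lambda>x. emeasure (\<beta> k) (Pair x -` ((\<lambda>(x, y). x + y) -` X k \<inter> space (\<alpha> k \<Otimes>\<^sub>M \<beta> k)))) \<in> borel_measurable (\<alpha> k)"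
      by (intro N.measurable_emeasure_Pair measurable_sets[OF measurable_add_borel_probs[OF \<alpha> \<beta>] X])
    then have "(\<lambda>x. emeasure (\<beta> k) {y. x + y \<in> X k}) \<in> borel_measurable (\<alpha> k)"
      by (simp add: space_pair_measure borel_probsD(3)[OF \<alpha>] borel_probsD(3)[OF \<beta>] vimage_def)
    then show ?thesis
      using measurable_cong_sets[OF borel_probsD(2)[OF \<alpha>] refl] by blast
  qed
  have "emeasure (product_meas \<alpha> \<circledast> product_meas \<beta>) {v. \<forall>k\<in>J. v k \<in> X k}
      = (\<integral>\<^sup>+v. emeasure (product_meas \<beta>) {w. \<forall>k\<in>J. w k \<in> {y. v k + y \<in> X k}} \<partial>product_meas \<alpha>)"
    by (subst emeasure_conv[OF P cylinder_sets_borel[OF J X]]) simp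
  also have "\<dots> = (\<integral>\<^sup>+v. (\<Prod>k\<in>J. emeasure (\<beta> k) {y. v k + y \<in> X k}) \<partial>product_meas \<alpha>)"
    by (intro nn_integral_cong emeasure_product_meas_cylinder \<beta> J shift)
  also have "\<dots> = (\<Prod>k\<in>J. \<integral>\<^sup>+x. emeasure (\<beta> k) {y. x + y \<in> X k} \<partial>\<alpha> k)"
    by (rule nn_integral_product_meas_prod[OF \<alpha> J meas])
  also have "\<dots> = (\<Prod>k\<in>J. emeasure (\<alpha> k \<circledast> \<beta> k) (X k))"
    by (intro prod.cong refl emeasure_conv[symmetric] \<alpha> \<beta> X)
  finally show "emeasure (product_meas \<alpha> \<circledast> product_meas \<beta>) {v. \<forall>k\<in>J. v k \<in> X k}
      = (\<Prod>k\<in>J. emeasure (\<alpha> k \<circledast> \<beta> k) (X k))" .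
qed

lemma product_meas_dirac:
  fixes v :: "int \<Rightarrow> 'a::second_countable_topology"
  shows "product_meas (\<lambda>k. dirac (v k)) = dirac v"
proof (rule product_meas_eqI[symmetric])
  fix J :: "int set" and X :: "int \<Rightarrow> 'a set" assume J: "finite J" and X: "\<And>k. X k \<in> sets borel"
  have "emeasure (dirac v) {v. \<forall>k\<in>J. v k \<in> X k} = indicator {v. \<forall>k\<in>J. v k \<in> X k} v"
    unfolding dirac_def using cylinder_sets_borel[OF J X] by simp
  also have "\<dots> = (\<Prod>k\<in>J. indicator (X k) (v k))"
  proof (cases "\<forall>k\<in>J. v k \<in> X k")
    case False
    then show ?thesis using J by (auto simp: indicator_def intro!: prod_zero[symmetric])
  qed simp
  also have "\<dots> = (\<Prod>k\<in>J. emeasure (dirac (v k)) (X k))"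
    using X by (intro prod.cong) (simp_all add: dirac_def)
  finally show "emeasure (dirac v) {v. \<forall>k\<in>J. v k \<in> X k} = (\<Prod>k\<in>J. emeasure (dirac (v k)) (X k))" .
qed (auto intro: dirac_in_borel_probs)

lemma continuous_on_coord: "continuous_on UNIV (coord k :: (int \<Rightarrow> 'a::topological_space) \<Rightarrow> 'a)"
  unfolding coord_def by (intro continuous_on_product_then_coordinatewise[OF continuous_on_id])

lemma continuous_on_shift_op:
  fixes \<phi> :: "'a::topological_space \<Rightarrow> 'a"
  assumes "continuous_on UNIV \<phi>"
  shows "continuous_on UNIV (shift_op \<phi>)"
  unfolding shift_op_def
  by (intro continuous_on_coordinatewise_then_product continuous_on_compose2[OF assms]
      continuous_on_product_then_coordinatewise[OF continuous_on_id]) auto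

lemma image_meas_coord_product_meas:
  fixes \<alpha> :: "int \<Rightarrow> 'a::second_countable_topology measure"
  assumes \<alpha>: "\<And>k. \<alpha> k \<in> borel_probs"
  shows "image_meas (coord k) (product_meas \<alpha>) = \<alpha> k"
proof -
  have "distr (PiM UNIV \<alpha>) (\<alpha> k) (\<lambda>v. v k) = \<alpha> k"
    by (rule distr_PiM_component) (auto intro: borel_probsD[OF \<alpha>])
  moreover have "distr (PiM UNIV \<alpha>) (\<alpha> k) (\<lambda>v. v k) = distr (PiM UNIV \<alpha>) borel (\<lambda>v. v k)"
    using borel_probsD(2)[OF \<alpha>] by (intro distr_cong) auto
  ultimately show ?thesis
    unfolding image_meas_def product_meas_def coord_def by simp
qed

lemma image_meas_shift_product_meas:
  fixes \<beta> :: "int \<Rightarrow> 'a::second_countable_topology measure"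
  assumes \<beta>: "\<And>k. \<beta> k \<in> borel_probs" and \<phi>: "continuous_on UNIV \<phi>"
  shows "image_meas (shift_op \<phi>) (product_meas \<beta>) = product_meas (\<lambda>k. image_meas \<phi> (\<beta> (k - 1)))"
proof (rule product_meas_eqI)
  note P = product_meas_in_borel_probs[of \<beta>, OF \<beta>]
  note sm = borel_measurable_continuous_onI[OF continuous_on_shift_op[OF \<phi>]]
  note \<phi>m = borel_measurable_continuous_onI[OF \<phi>]
  show "image_meas \<phi> (\<beta> (k - 1)) \<in> borel_probs" for k by (rule image_meas_in_borel_probs[OF \<beta> \<phi>m])
  show "image_meas (shift_op \<phi>) (product_meas \<beta>) \<in> borel_probs" by (rule image_meas_in_borel_probs[OF P sm])
  fix J :: "int set" and X :: "int \<Rightarrow> 'a set" assume J: "finite J" and X: "\<And>k. X k \<in> sets borel"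
  have pre: "\<phi> -` X k \<in> sets borel" for k
    using measurable_sets[OF \<phi>m X] by simp
  have "emeasure (image_meas (shift_op \<phi>) (product_meas \<beta>)) {v. \<forall>k\<in>J. v k \<in> X k}
      = emeasure (product_meas \<beta>) (shift_op \<phi> -` {v. \<forall>k\<in>J. v k \<in> X k} \<inter> space (product_meas \<beta>))"
    unfolding image_meas_def
    by (rule emeasure_distr[OF borel_probs_measurable[OF P sm] cylinder_sets_borel[OF J X]])
  also have "shift_op \<phi> -` {v. \<forall>k\<in>J. v k \<in> X k} \<inter> space (product_meas \<beta>)
      = {v. \<forall>k\<in>(\<lambda>k. k - 1) ` J. v k \<in> \<phi> -` X (k + 1)}"
    by (auto simp: shift_op_def borel_probsD(3)[OF P])
  also have "emeasure (product_meas \<beta>) \<dots> = (\<Prod>k\<in>(\<lambda>k. k - 1) ` J. emeasure (\<beta> k) (\<phi> -` X (k + 1)))"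
    by (intro emeasure_product_meas_cylinder \<beta> finite_imageI J pre)
  also have "\<dots> = (\<Prod>k\<in>J. emeasure (\<beta> (k - 1)) (\<phi> -` X k))"
    by (subst prod.reindex) (auto simp: inj_on_def)
  also have "\<dots> = (\<Prod>k\<in>J. emeasure (image_meas \<phi> (\<beta> (k - 1))) (X k))"
    unfolding image_meas_def
    by (intro prod.cong refl) (simp add: emeasure_distr[OF borel_probs_measurable[OF \<beta> \<phi>m] X] borel_probsD(3)[OF \<beta>])
  finally show "emeasure (image_meas (shift_op \<phi>) (product_meas \<beta>)) {v. \<forall>k\<in>J. v k \<in> X k}
      = (\<Prod>k\<in>J. emeasure (image_meas \<phi> (\<beta> (k - 1))) (X k))" .
qed

lemma weak_limit_dirac_0_norm:
  fixes M :: "nat \<Rightarrow> 'a::real_normed_vector measure"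
  assumes lim: "weak_limit M (dirac 0)" and M: "\<And>n. M n \<in> borel_probs" and "0 < \<epsilon>"
  shows "(\<lambda>n. measure (M n) {x. \<epsilon> \<le> norm x}) \<longlonglongrightarrow> 0"
proof (rule tendsto_sandwich[where f = "\<lambda>_. 0" and h = "\<lambda>n. \<integral>x. min 1 (norm x / \<epsilon>) \<partial>M n"])
  have f: "continuous_on UNIV (\<lambda>x :: 'a. min 1 (norm x / \<epsilon>))"
    using \<open>0 < \<epsilon>\<close> by (intro continuous_intros) auto
  note fm = borel_measurable_continuous_onI[OF f]
  have b: "\<bar>min 1 (norm x / \<epsilon>)\<bar> \<le> 1" for x :: 'a using \<open>0 < \<epsilon>\<close> by auto
  show "(\<lambda>n. \<integral>x. min 1 (norm x / \<epsilon>) \<partial>M n) \<longlonglongrightarrow> 0"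
    using weak_limitD[OF lim f b] by (simp add: integral_dirac[OF fm])
  have cl: "{x :: 'a. \<epsilon> \<le> norm x} \<in> sets borel"
    by (rule borel_closed, rule closed_Collect_le) (intro continuous_intros)+
  show "\<forall>\<^sub>F n in sequentially. measure (M n) {x. \<epsilon> \<le> norm x} \<le> (\<integral>x. min 1 (norm x / \<epsilon>) \<partial>M n)"
  proof (intro always_eventually allI)
    fix n
    have "(\<integral>x. indicator {x. \<epsilon> \<le> norm x} x \<partial>M n) \<le> (\<integral>x. min 1 (norm x / \<epsilon>) \<partial>M n)"
    proof (rule integral_mono)
      show "integrable (M n) (indicat_real {x. \<epsilon> \<le> norm x})"
        by (rule integrable_borel_probs[OF M, where B = 1]) (use cl in auto)
      show "integrable (M n) (\<lambda>x. min 1 (norm x / \<epsilon>))"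
        by (rule integrable_borel_probs[OF M fm, where B = 1]) (use b in auto)
    qed (use \<open>0 < \<epsilon>\<close> in \<open>auto simp: indicator_def\<close>)
    then show "measure (M n) {x. \<epsilon> \<le> norm x} \<le> (\<integral>x. min 1 (norm x / \<epsilon>) \<partial>M n)"
      by (simp add: borel_probsD[OF M])
  qed
qed simp_all

text \<open>A basic neighbourhood of 0 restricts finitely many coordinates, so its complement is
  covered by finitely many coordinate tails. Convergence of the marginals therefore suffices,
  whatever the dependence between coordinates.\<close>

lemma weak_limit_dirac_0_coordinatewise:
  fixes M :: "nat \<Rightarrow> (int \<Rightarrow> 'a::{real_normed_vector, second_countable_topology}) measure"
  assumes M: "\<And>n. M n \<in> borel_probs"
    and lim: "\<And>k. weak_limit (\<lambda>n. image_meas (coord k) (M n)) (dirac 0)"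
  shows "weak_limit M (dirac 0)"
proof (rule weak_limit_diracI[OF M])
  fix U :: "(int \<Rightarrow> 'a) set" assume U: "open U" "0 \<in> U"
  then obtain X where X: "0 \<in> (\<Pi>\<^sub>E i\<in>UNIV. X i)" "\<And>i. open (X i)" "finite {i. X i \<noteq> UNIV}" "(\<Pi>\<^sub>E i\<in>UNIV. X i) \<subseteq> U"
    using product_topology_open_contains_basis[of "\<lambda>_. euclidean" UNIV U 0] by (auto simp: open_fun_def)
  define J where "J = {i. X i \<noteq> UNIV}"
  have "\<exists>e>0. ball 0 e \<subseteq> X i" for i
    using X(1) X(2)[of i] open_contains_ball_eq[of "X i" 0] by (auto simp: PiE_iff zero_fun_def)
  then obtain e where e: "\<And>i. 0 < e i" "\<And>i. ball 0 (e i) \<subseteq> X i" by metis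
  have cm: "coord k \<in> borel_measurable borel" for k
    by (intro borel_measurable_continuous_onI continuous_on_coord)
  have cl: "{x :: 'a. r \<le> norm x} \<in> sets borel" for r
    by (rule borel_closed, rule closed_Collect_le) (intro continuous_intros)+
  have le: "measure (M n) (- U) \<le> (\<Sum>k\<in>J. measure (image_meas (coord k) (M n)) {x. e k \<le> norm x})" for n
  proof -
    interpret prob_space "M n" by (rule borel_probsD[OF M])
    have sub: "- U \<subseteq> (\<Union>k\<in>J. coord k -` {x. e k \<le> norm x} \<inter> space (M n))"
    proof
      fix v assume "v \<in> - U"
      then obtain i where "v i \<notin> X i" using X(4) by (auto simp: PiE_iff)
      then have "i \<in> J" "e i \<le> norm (v i)" using e(2)[of i] by (auto simp: J_def subset_eq not_less)
      then show "v \<in> (\<Union>k\<in>J. coord k -` {x. e k \<le> norm x} \<inter> space (M n))"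
        by (auto simp: coord_def borel_probsD(3)[OF M])
    qed
    have ev: "coord k -` {x. e k \<le> norm x} \<inter> space (M n) \<in> events" for k
      by (rule measurable_sets[OF borel_probs_measurable[OF M cm] cl])
    have fin: "finite J" using X(3) by (simp add: J_def)
    have "measure (M n) (- U) \<le> measure (M n) (\<Union>k\<in>J. coord k -` {x. e k \<le> norm x} \<inter> space (M n))"
      using ev fin by (intro finite_measure_mono sub sets.finite_UN)
    also have "\<dots> \<le> (\<Sum>k\<in>J. measure (M n) (coord k -` {x. e k \<le> norm x} \<inter> space (M n)))"
      using ev fin by (intro finite_measure_subadditive_finite) auto
    also have "\<dots> = (\<Sum>k\<in>J. measure (image_meas (coord k) (M n)) {x. e k \<le> norm x})"
      unfolding image_meas_def
      by (intro sum.cong refl measure_distr[symmetric] borel_probs_measurable[OF M cm]) (simp add: cl)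
    finally show ?thesis .
  qed
  have "(\<lambda>n. \<Sum>k\<in>J. measure (image_meas (coord k) (M n)) {x. e k \<le> norm x}) \<longlonglongrightarrow> (\<Sum>k\<in>J. 0)"
    by (intro tendsto_sum weak_limit_dirac_0_norm lim e image_meas_in_borel_probs[OF M cm])
  then have "(\<lambda>n. \<Sum>k\<in>J. measure (image_meas (coord k) (M n)) {x. e k \<le> norm x}) \<longlonglongrightarrow> 0" by simp
  then show "(\<lambda>n. measure (M n) (- U)) \<longlonglongrightarrow> 0"
    by (rule tendsto_sandwich[OF _ _ tendsto_const, rotated 2]) (simp_all add: le)
qed

subsection \<open>Removing the operator\<close>

lemma int_iterate_0: "int_iterate f 0 = id"
  by (simp add: int_iterate_def)

lemma int_iterate_of_nat: "int_iterate f (int n) = f ^^ n"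
  by (simp add: int_iterate_def)

lemma int_iterate_step:
  assumes "bij f"
  shows "f (int_iterate f (k - 1) x) = int_iterate f k x"
proof (cases "0 < k")
  case True
  then have "nat k = Suc (nat (k - 1))" by simp
  with True show ?thesis by (simp add: int_iterate_def)
next
  case False
  then have "nat (- (k - 1)) = Suc (nat (- k))" by simp
  with False assms show ?thesis
    by (auto simp: int_iterate_def bij_is_surj surj_f_inv_f)
qed

lemma int_iterate_add_of_nat:
  assumes "bij f"
  shows "(f ^^ n) (int_iterate f k x) = int_iterate f (k + int n) x"
proof (induction n)
  case (Suc n)
  then show ?case
    using int_iterate_step[OF assms, of "k + int (Suc n)" x] by (simp add: algebra_simps)
qed simp

lemma int_iterate_add:
  assumes "bij f"
  shows "int_iterate f j (int_iterate f k x) = int_iterate f (j + k) x"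
proof (cases "0 \<le> j")
  case True
  then obtain n where "j = int n" by (metis nonneg_int_cases)
  then show ?thesis
    by (simp add: int_iterate_of_nat int_iterate_add_of_nat[OF assms] add.commute)
next
  case False
  \<comment> \<open>A negative iterate is the inverse of \<open>f ^^ n\<close>, so the identity can
    be checked after applying \<open>f ^^ n\<close>.\<close>
  then obtain n where j: "j = - int n" by (metis nonpos_int_cases linorder_not_le less_imp_le)
  have "int_iterate f j y = inv (f ^^ n) y" for y
    using int_iterate_add_of_nat[OF assms, of n j y] bij_fn[OF assms, of n]
    by (simp add: j int_iterate_0 inv_f_eq bij_is_inj)
  moreover have "(f ^^ n) (int_iterate f (j + k) x) = int_iterate f k x"
    using int_iterate_add_of_nat[OF assms, of n "j + k" x] by (simp add: j)
  ultimately show ?thesis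
    using bij_fn[OF assms, of n] by (metis bij_is_inj inv_f_f)
qed

lemma linear_int_iterate:
  fixes f :: "'a::euclidean_space \<Rightarrow> 'a"
  assumes "linear f" "bij f"
  shows "linear (int_iterate f k)"
proof -
  have pow: "linear (g ^^ n)" if "linear g" for g :: "'a \<Rightarrow> 'a" and n
  proof (induction n)
    case (Suc n)
    show ?case unfolding funpow.simps by (rule linear_compose[OF Suc that])
  qed (simp add: linear_ident id_def)
  have "linear (inv f)"
    using assms by (intro inj_linear_imp_inv_linear bij_is_inj)
  then show ?thesis
    by (simp add: int_iterate_def pow assms(1))
qed

lemma shift_op_funpow: "(shift_op \<phi> ^^ n) v k = (\<phi> ^^ n) (v (k - int n))"
  by (induction n arbitrary: k) (simp_all add: shift_op_def algebra_simps)

section \<open>Equation (E), chains and strong decomposability\<close>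

locale invertible_operator =
  fixes \<phi> :: "real ^ 'd \<Rightarrow> real ^ 'd"
  assumes linear: "linear \<phi>" and bij: "bij \<phi>"
begin

abbreviation T :: "int \<Rightarrow> (real ^ 'd) measure \<Rightarrow> (real ^ 'd) measure" where
  "T k \<equiv> image_meas (int_iterate \<phi> k)"

lemma continuous_on_int_iterate: "continuous_on UNIV (int_iterate \<phi> k)"
  by (intro linear_continuous_on linear_linear[THEN iffD2] linear_int_iterate linear bij)

lemma borel_measurable_int_iterate: "int_iterate \<phi> k \<in> borel_measurable borel"
  by (rule borel_measurable_continuous_onI[OF continuous_on_int_iterate])

lemma T_in_borel_probs: "M \<in> borel_probs \<Longrightarrow> T k M \<in> borel_probs"
  by (rule image_meas_in_borel_probs[OF _ borel_measurable_int_iterate])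

lemma T_T: "M \<in> borel_probs \<Longrightarrow> T j (T k M) = T (j + k) M"
  by (subst image_meas_image_meas[OF _ borel_measurable_int_iterate borel_measurable_int_iterate])
    (simp_all add: o_def int_iterate_add[OF bij])

lemma T_0: "M \<in> borel_probs \<Longrightarrow> T 0 M = M"
  using image_meas_id by (simp add: int_iterate_0 id_def)

lemma T_1: "image_meas \<phi> M = T 1 M"
  using int_iterate_of_nat[of \<phi> 1] by simp

lemma T_conv: "M \<in> borel_probs \<Longrightarrow> N \<in> borel_probs \<Longrightarrow> T k (M \<circledast> N) = T k M \<circledast> T k N"
  by (rule image_meas_conv[OF _ _ borel_measurable_int_iterate])
    (auto intro: linear_add linear_int_iterate linear bij)

lemma T_dirac: "T k (dirac x) = dirac (int_iterate \<phi> k x)"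
  by (rule image_meas_dirac[OF borel_measurable_int_iterate])

lemma solution_imp_conv_chain:
  assumes \<mu>: "\<And>k. \<mu> k \<in> borel_probs" and "solution \<mu> \<phi> \<Lambda>"
  shows "conv_chain (\<lambda>k. T (- k) (\<mu> k)) (\<lambda>k. T (- k) (\<Lambda> k))"
  unfolding conv_chain_def
proof (intro conjI allI)
  fix k
  have \<Lambda>p: "\<Lambda> k \<in> borel_probs" and rec: "\<Lambda> k = \<mu> k \<circledast> T 1 (\<Lambda> (k - 1))" for k
    using assms(2) unfolding solution_def T_1 by blast+
  show "T (- k) (\<Lambda> k) \<in> borel_probs" by (rule T_in_borel_probs[OF \<Lambda>p])
  have "T (- k) (\<Lambda> k) = T (- k) (\<mu> k \<circledast> T 1 (\<Lambda> (k - 1)))"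
    by (rule arg_cong[OF rec])
  also have "\<dots> = T (- k) (\<mu> k) \<circledast> T (- k + 1) (\<Lambda> (k - 1))"
    by (simp only: T_conv T_T T_in_borel_probs \<mu> \<Lambda>p)
  finally show "T (- k) (\<Lambda> k) = T (- k) (\<mu> k) \<circledast> T (- (k - 1)) (\<Lambda> (k - 1))"
    by simp
qed

lemma conv_chain_imp_solution:
  assumes \<mu>: "\<And>k. \<mu> k \<in> borel_probs" and chain: "conv_chain (\<lambda>k. T (- k) (\<mu> k)) \<Lambda>"
  shows "solution \<mu> \<phi> (\<lambda>k. T k (\<Lambda> k))"
  unfolding solution_def T_1
proof (intro conjI allI)
  fix k
  note \<Lambda>p = conv_chainD(1)[OF chain]
  show "T k (\<Lambda> k) \<in> borel_probs" by (rule T_in_borel_probs[OF \<Lambda>p])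
  have "T k (\<Lambda> k) = T k (T (- k) (\<mu> k) \<circledast> \<Lambda> (k - 1))"
    by (rule arg_cong[OF conv_chainD(2)[OF chain]])
  also have "\<dots> = T (k + - k) (\<mu> k) \<circledast> T k (\<Lambda> (k - 1))"
    by (simp only: T_conv T_T T_in_borel_probs \<mu> \<Lambda>p)
  also have "\<dots> = \<mu> k \<circledast> T (1 + (k - 1)) (\<Lambda> (k - 1))"
    by (simp add: T_0 \<mu>)
  also have "\<dots> = \<mu> k \<circledast> T 1 (T (k - 1) (\<Lambda> (k - 1)))"
    by (simp only: T_T \<Lambda>p)
  finally show "T k (\<Lambda> k) = \<mu> k \<circledast> T 1 (T (k - 1) (\<Lambda> (k - 1)))" .
qed

text \<open>The limit says that the chain of the \<open>T (- k) (\<Lambda> k)\<close> concentrates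
  as \<open>k\<close> tends to minus infinity, up to translations. \<open>conv_chain_factor\<close>
  then yields one \<open>\<nu>\<close> for all \<open>k\<close>, and applying \<open>T k\<close>
  turns it into the required co-factor \<open>T k \<nu>\<close>.\<close>

lemma fundamental_solutionI:
  assumes \<mu>: "\<And>k. \<mu> k \<in> borel_probs" and sol: "solution \<mu> \<phi> \<Lambda>"
    and lim: "weak_limit (\<lambda>n. T (int n) (\<Lambda> (- int n)) \<circledast> dirac (b n)) (dirac 0)"
  shows "fundamental_solution \<mu> \<phi> \<Lambda>"
  unfolding fundamental_solution_def
proof (intro conjI allI impI sol)
  fix N assume N: "solution \<mu> \<phi> N"
  have \<Lambda>p: "\<Lambda> k \<in> borel_probs" and Np: "N k \<in> borel_probs" for k
    using sol N unfolding solution_def by blast+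
  have "\<exists>\<nu>\<in>borel_probs. \<forall>k. T (- k) (N k) = T (- k) (\<Lambda> k) \<circledast> \<nu>"
    using solution_imp_conv_chain[OF \<mu> sol] solution_imp_conv_chain[OF \<mu> N] lim
    by (intro conv_chain_factor[where \<mu> = "\<lambda>k. T (- k) (\<mu> k)" and b = b] T_in_borel_probs \<mu>) simp_all
  then obtain \<nu> where \<nu>: "\<nu> \<in> borel_probs" and eq: "\<And>k. T (- k) (N k) = T (- k) (\<Lambda> k) \<circledast> \<nu>"
    by blast
  have "N k = \<Lambda> k \<circledast> T k \<nu>" for k
  proof -
    have "N k = T (k + - k) (N k)" by (simp add: T_0 Np)
    also have "\<dots> = T k (T (- k) (\<Lambda> k) \<circledast> \<nu>)" by (simp only: T_T Np flip: eq)
    also have "\<dots> = T (k + - k) (\<Lambda> k) \<circledast> T k \<nu>" by (simp only: T_conv T_T T_in_borel_probs \<Lambda>p \<nu>)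
    finally show ?thesis by (simp add: T_0 \<Lambda>p)
  qed
  with \<nu> show "\<exists>\<nu>\<in>borel_probs. \<forall>k. N k = \<Lambda> k \<circledast> T k \<nu>" by blast
qed

lemma continuous_on_\<phi>: "continuous_on UNIV \<phi>"
  using continuous_on_int_iterate[of 1] int_iterate_of_nat[of \<phi> 1] by simp

lemma borel_measurable_shift_op_funpow: "shift_op \<phi> ^^ n \<in> borel_measurable borel"
proof (rule borel_measurable_continuous_onI)
  show "continuous_on UNIV (shift_op \<phi> ^^ n)"
    by (induction n) (auto simp: o_def intro: continuous_on_compose2[OF continuous_on_shift_op[OF continuous_on_\<phi>]])
qed

lemma borel_measurable_coord: "coord k \<in> borel_measurable borel"
  by (rule borel_measurable_continuous_onI[OF continuous_on_coord])

lemma image_meas_coord_shift_op: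
  assumes L: "L \<in> borel_probs"
  shows "image_meas (coord k) (image_meas (shift_op \<phi> ^^ n) L) = T (int n) (image_meas (coord (k - int n)) L)"
proof -
  have "coord k \<circ> (shift_op \<phi> ^^ n) = int_iterate \<phi> (int n) \<circ> coord (k - int n)"
    by (auto simp: coord_def shift_op_funpow int_iterate_of_nat)
  then show ?thesis
    by (simp add: image_meas_image_meas[OF L borel_measurable_shift_op_funpow borel_measurable_coord]
        image_meas_image_meas[OF L borel_measurable_coord borel_measurable_int_iterate])
qed

lemma strongly_decomposable_imp_fundamental_solution:
  assumes \<mu>: "\<And>k. \<mu> k \<in> borel_probs"
    and L: "strongly_decomposable (shift_op \<phi>) (product_meas \<mu>) L"
  shows "fundamental_solution \<mu> \<phi> (\<lambda>k. image_meas (coord k) L)"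
proof (rule fundamental_solutionI[OF \<mu>])
  have Lp: "L \<in> borel_probs" and rec: "L = product_meas \<mu> \<circledast> image_meas (shift_op \<phi> ^^ 1) L"
    and lim: "weak_limit (\<lambda>n. image_meas (shift_op \<phi> ^^ n) L) (dirac 0)"
    using L unfolding strongly_decomposable_def decomposable_def by simp_all
  note \<tau>p = image_meas_in_borel_probs[OF Lp borel_measurable_shift_op_funpow]
  have cp: "image_meas (coord k) L \<in> borel_probs" for k
    by (rule image_meas_in_borel_probs[OF Lp borel_measurable_coord])
  show "solution \<mu> \<phi> (\<lambda>k. image_meas (coord k) L)"
    unfolding solution_def T_1
  proof (intro conjI allI cp)
    fix k
    have "image_meas (coord k) L = image_meas (coord k) (product_meas \<mu> \<circledast> image_meas (shift_op \<phi> ^^ 1) L)"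
      by (rule arg_cong[OF rec])
    also have "\<dots> = image_meas (coord k) (product_meas \<mu>) \<circledast> image_meas (coord k) (image_meas (shift_op \<phi> ^^ 1) L)"
      by (rule image_meas_conv[OF product_meas_in_borel_probs[of \<mu>, OF \<mu>] \<tau>p borel_measurable_coord])
        (simp add: coord_def)
    also have "\<dots> = \<mu> k \<circledast> T 1 (image_meas (coord (k - 1)) L)"
      unfolding image_meas_coord_shift_op[OF Lp] image_meas_coord_product_meas[of \<mu>, OF \<mu>] by simp
    finally show "image_meas (coord k) L = \<mu> k \<circledast> T 1 (image_meas (coord (k - 1)) L)" .
  qed
  \<comment> \<open>Coordinate 0 of the iterates is \<open>T (int n)\<close> of the marginal at
    \<open>- int n\<close>, so the criterion is met with all shifts equal to 0.\<close>
  have "weak_limit (\<lambda>n. image_meas (coord 0) (image_meas (shift_op \<phi> ^^ n) L)) (image_meas (coord 0) (dirac 0))"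
    by (rule weak_limit_image[OF lim \<tau>p dirac_in_borel_probs continuous_on_coord])
  then show "weak_limit (\<lambda>n. T (int n) (image_meas (coord (- int n)) L) \<circledast> dirac 0) (dirac 0)"
    by (simp add: image_meas_coord_shift_op[OF Lp] image_meas_dirac[OF borel_measurable_coord]
        conv_dirac_0 T_in_borel_probs cp) (simp add: coord_def)
qed

lemma solution_imp_ex_centred:
  assumes \<mu>: "\<And>k. \<mu> k \<in> borel_probs" and "solution \<mu> \<phi> N"
  shows "\<exists>\<Lambda> b. solution \<mu> \<phi> \<Lambda> \<and> weak_limit (\<lambda>n. T (int n) (\<Lambda> (- int n)) \<circledast> dirac (b n)) (dirac 0)"
proof -
  obtain \<Lambda> b where chain: "conv_chain (\<lambda>k. T (- k) (\<mu> k)) \<Lambda>"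
    and lim: "weak_limit (\<lambda>n. \<Lambda> (- int n) \<circledast> dirac (b n)) (dirac 0)"
    using conv_chain_ex_centred[OF _ solution_imp_conv_chain[OF assms]] T_in_borel_probs[OF \<mu>] by blast
  have "T (int n) (T (- int n) (\<Lambda> (- int n))) = \<Lambda> (- int n)" for n
    using conv_chainD(1)[OF chain] by (simp add: T_T T_0)
  then show ?thesis
    using conv_chain_imp_solution[OF \<mu> chain] lim
    by (intro exI[of _ "\<lambda>k. T k (\<Lambda> k)"] exI[of _ b]) simp
qed

text \<open>The strongly decomposable measure is the product of the recentred \<open>\<Lambda> k\<close>: the \<open>\<Lambda> k\<close> are
  coupled independently.\<close>

lemma centred_solution_imp_strongly_decomposable:
  assumes \<mu>: "\<And>k. \<mu> k \<in> borel_probs" and sol: "solution \<mu> \<phi> \<Lambda>"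
    and lim: "weak_limit (\<lambda>n. T (int n) (\<Lambda> (- int n)) \<circledast> dirac (b n)) (dirac 0)"
  shows "\<exists>v L. strongly_decomposable (shift_op \<phi>) (product_meas \<mu> \<circledast> dirac v) L"
proof -
  note d = dirac_in_borel_probs
  have \<Lambda>p: "\<Lambda> k \<in> borel_probs" and rec: "\<Lambda> k = \<mu> k \<circledast> T 1 (\<Lambda> (k - 1))" for k
    using sol unfolding solution_def T_1 by blast+
  \<comment> \<open>The centre \<open>b (- k)\<close> of the chain carried back by
    \<open>\<phi>^k\<close>; for \<open>k > 0\<close> the truncation \<open>nat (- k) = 0\<close>
    selects \<open>b 0\<close>.\<close>
  define a where "a k = int_iterate \<phi> k (b (nat (- k)))" for k
  \<comment> \<open>Exactly the correction by which recentring \<open>\<Lambda> k\<close> and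
    \<open>\<Lambda> (k - 1)\<close> changes the factor \<open>\<mu> k\<close>.\<close>
  define v where "v k = a k - \<phi> (a (k - 1))" for k
  define K where "K k = \<Lambda> k \<circledast> dirac (a k)" for k
  have Kp: "K k \<in> borel_probs" for k by (simp add: K_def conv_in_borel_probs \<Lambda>p d)
  have \<mu>v: "\<mu> k \<circledast> dirac (v k) \<in> borel_probs" for k by (simp add: conv_in_borel_probs \<mu> d)
  have Krec: "K k = (\<mu> k \<circledast> dirac (v k)) \<circledast> T 1 (K (k - 1))" for k
  proof -
    have "K k = (\<mu> k \<circledast> T 1 (\<Lambda> (k - 1))) \<circledast> dirac (a k)"
      unfolding K_def by (simp flip: rec)
    also have "\<dots> = (\<mu> k \<circledast> T 1 (\<Lambda> (k - 1))) \<circledast> (dirac (v k) \<circledast> dirac (\<phi> (a (k - 1))))"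
      by (simp add: dirac_conv_dirac v_def)
    also have "\<dots> = (\<mu> k \<circledast> dirac (v k)) \<circledast> (T 1 (\<Lambda> (k - 1)) \<circledast> dirac (\<phi> (a (k - 1))))"
      by (simp add: conv_assoc conv_left_commute[of "dirac (v k)"] conv_in_borel_probs T_in_borel_probs \<mu> \<Lambda>p d)
    also have "T 1 (\<Lambda> (k - 1)) \<circledast> dirac (\<phi> (a (k - 1))) = T 1 (K (k - 1))"
      unfolding K_def T_conv[OF \<Lambda>p d] T_dirac using int_iterate_of_nat[of \<phi> 1] by simp
    finally show ?thesis .
  qed
  define L where "L = product_meas K"
  have Lp: "L \<in> borel_probs" unfolding L_def by (rule product_meas_in_borel_probs[of K, OF Kp])
  have P: "product_meas \<mu> \<circledast> dirac v = product_meas (\<lambda>k. \<mu> k \<circledast> dirac (v k))"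
    unfolding product_meas_dirac[symmetric] by (rule product_meas_conv[OF \<mu> d])
  have "L = product_meas (\<lambda>k. (\<mu> k \<circledast> dirac (v k)) \<circledast> image_meas \<phi> (K (k - 1)))"
    unfolding L_def T_1 by (simp flip: Krec)
  also have "\<dots> = product_meas (\<lambda>k. \<mu> k \<circledast> dirac (v k)) \<circledast> product_meas (\<lambda>k. image_meas \<phi> (K (k - 1)))"
    by (rule product_meas_conv[symmetric, OF \<mu>v]) (simp add: T_1 T_in_borel_probs Kp)
  also have "\<dots> = (product_meas \<mu> \<circledast> dirac v) \<circledast> image_meas (shift_op \<phi>) L"
    unfolding P L_def image_meas_shift_product_meas[of K, OF Kp continuous_on_\<phi>] ..
  finally have dec: "decomposable (shift_op \<phi>) (product_meas \<mu> \<circledast> dirac v) L"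
    unfolding decomposable_def using Lp by (simp add: P product_meas_in_borel_probs \<mu>v)
  define \<sigma> where "\<sigma> n = T (int n) (\<Lambda> (- int n)) \<circledast> dirac (b n)" for n
  have \<sigma>p: "\<sigma> n \<in> borel_probs" for n by (simp add: \<sigma>_def conv_in_borel_probs T_in_borel_probs \<Lambda>p d)
  \<comment> \<open>The choice of \<open>a\<close> makes the shifts agree: with
    \<open>m = n - k\<close>, the left side is \<open>T k\<close> of the centred measure
    \<open>\<sigma> m\<close>.\<close>
  have TK: "T (int n) (K (k - int n)) = T k (\<sigma> (nat (int n - k)))" if "k \<le> int n" for k n
  proof -
    define m where "m = nat (int n - k)"
    have km: "k - int n = - int m" "int n + - int m = k" using that by (simp_all add: m_def)
    have "T (int n) (K (- int m)) = T (int n) (\<Lambda> (- int m)) \<circledast> dirac (int_iterate \<phi> (int n + - int m) (b m))"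
      by (simp add: K_def T_conv T_dirac \<Lambda>p d a_def int_iterate_add[OF bij])
    also have "\<dots> = T k (\<sigma> m)"
    proof -
      have "k + int m = int n" using km by simp
      then show ?thesis
        by (simp add: \<sigma>_def T_conv T_dirac T_T T_in_borel_probs \<Lambda>p d km(2)[simplified])
    qed
    finally show ?thesis by (simp only: km(1)) (simp add: m_def)
  qed
  have "weak_limit (\<lambda>n. image_meas (shift_op \<phi> ^^ n) L) (dirac 0)"
  proof (rule weak_limit_dirac_0_coordinatewise)
    show "image_meas (shift_op \<phi> ^^ n) L \<in> borel_probs" for n
      by (rule image_meas_in_borel_probs[OF Lp borel_measurable_shift_op_funpow])
    fix k
    have "weak_limit (\<lambda>n. T k (\<sigma> n)) (T k (dirac 0))"
      by (rule weak_limit_image[OF lim[folded \<sigma>_def] \<sigma>p d continuous_on_int_iterate])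
    then have "weak_limit (\<lambda>n. T k (\<sigma> n)) (dirac 0)"
      by (simp add: T_dirac linear_0 linear_int_iterate linear bij)
    moreover have "filterlim (\<lambda>n. nat (int n - k)) sequentially sequentially"
      unfolding filterlim_at_top
    proof
      fix m :: nat
      show "\<forall>\<^sub>F n in sequentially. m \<le> nat (int n - k)"
        by (rule eventually_sequentiallyI[of "nat (int m + \<bar>k\<bar>)"]) linarith
    qed
    ultimately have "weak_limit (\<lambda>n. T k (\<sigma> (nat (int n - k)))) (dirac 0)"
      unfolding weak_limit_def by (auto intro: filterlim_compose)
    then have "weak_limit (\<lambda>n. T (int n) (K (k - int n))) (dirac 0)"
      by (rule weak_limit_cong) (auto intro!: eventually_sequentiallyI[of "nat k"] simp: TK)
    then show "weak_limit (\<lambda>n. image_meas (coord k) (image_meas (shift_op \<phi> ^^ n) L)) (dirac 0)"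
      by (simp add: image_meas_coord_shift_op[OF Lp]) (simp add: L_def image_meas_coord_product_meas Kp)
  qed
  with dec show ?thesis unfolding strongly_decomposable_def by blast
qed

end

theorem theorem1p1:
  fixes \<mu> :: "int \<Rightarrow> (real ^ 'd) measure"
    and \<phi> :: "real ^ 'd \<Rightarrow> real ^ 'd"
  assumes "\<And>k. \<mu> k \<in> borel_probs"
    and "linear \<phi>" and "bij \<phi>"
  shows "(\<forall>L. strongly_decomposable (shift_op \<phi>) (product_meas \<mu>) L \<longrightarrow>
            fundamental_solution \<mu> \<phi> (\<lambda>k. image_meas (coord k) L)) \<and>
         ((\<exists>\<Lambda>. solution \<mu> \<phi> \<Lambda>) \<longrightarrow>
            (\<exists>v L. strongly_decomposable (shift_op \<phi>) (product_meas \<mu> \<circledast> dirac v) L) \<and>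
            (\<exists>\<Lambda>. fundamental_solution \<mu> \<phi> \<Lambda>))"
proof -
  interpret invertible_operator \<phi> by (rule invertible_operator.intro[OF assms(2,3)])
  show ?thesis
  proof (intro conjI allI impI)
    fix L assume "strongly_decomposable (shift_op \<phi>) (product_meas \<mu>) L"
    with assms(1) show "fundamental_solution \<mu> \<phi> (\<lambda>k. image_meas (coord k) L)"
      by (rule strongly_decomposable_imp_fundamental_solution)
  next
    assume "\<exists>\<Lambda>. solution \<mu> \<phi> \<Lambda>"
    \<comment> \<open>One solution serves both claims: the product of its recentred members is
      strongly decomposable, and the solution itself is fundamental.\<close>
    then obtain \<Lambda> b where sol: "solution \<mu> \<phi> \<Lambda>"
      and lim: "weak_limit (\<lambda>n. T (int n) (\<Lambda> (- int n)) \<circledast> dirac (b n)) (dirac 0)"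
      using solution_imp_ex_centred[of \<mu>, OF assms(1)] by blast
    show "\<exists>v L. strongly_decomposable (shift_op \<phi>) (product_meas \<mu> \<circledast> dirac v) L"
      by (rule centred_solution_imp_strongly_decomposable[of \<mu>, OF assms(1) sol lim])
    show "\<exists>\<Lambda>. fundamental_solution \<mu> \<phi> \<Lambda>"
      using fundamental_solutionI[of \<mu>, OF assms(1) sol lim] by blast
  qed
qed

end
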